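(* Let $G=(V,E)$ be a simple connected undirected graph that is locally finite and transient (for the simple random walk), let a local mechanism $\tau_x$ be fixed at every vertex $x\in V$, and let $a\in V$. Suppose that every tree (connected component of the underlying unoriented graph) in the wired spanning forest oriented toward infinity $\mathsf{WSF}$ of $G$ has a single end almost surely. Then, for all $x\in V$, $$\mathbb{E}_{\rho\sim\mathsf{WSF}}\,[u(\rho)(x)]=\mathcal{G}(x),$$ where $u(\rho)(x)$ is the number of visits to $x$ by the rotor walk with initial location $a$, empty sink and initial rotor configuration $\rho$, and $\mathcal{G}(x)$ is the expected number of visits to $x$ by the simple random walk on $G$ started at $a$.
   Context: Local mechanisms and rotor configurations. Each vertex $x\in V$ carries a local mechanism $\tau_x$, a bijection of the neighbor set $N(x)$ having a single orbit, i.e. $\{\tau_x^i(y): i\ge 0\}=N(x)$ for every $y\in N(x)$. A rotor configuration is a function $\rho:V\to V$ with $\rho(x)\in N(x)$ for all $x$. Rotor walk (empty sink). Given $a\in V$ and a rotor configuration $\rho$, set $X_0=a$, $\rho_0=\rho$, and for $t\ge 0$: $X_{t+1}=\tau_{X_t}(\rho_t(X_t))$, $\rho_{t+1}(X_t)=\tau_{X_t}(\rho_t(X_t))$, and $\rho_{t+1}(x)=\rho_t(x)$ for $x\ne X_t$. The number of visits is $u(\rho)(x)=|\{t\ge 0: X_t=x\}|$ (time $0$ is counted, also for the simple random walk). Wired spanning forest. For $Z\subseteq V$, a $Z$-oriented spanning forest of $G$ is an oriented subgraph $F$ of $G$ in which every vertex of $Z$ has outdegree $0$, every vertex of $V\setminus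 Z$ has outdegree $1$, and there are no oriented cycles (including cycles of length 2). If $V\setminus Z$ is finite, $\mathsf{USF}(Z)$ is the uniform probability measure on the (finitely many) $Z$-oriented spanning forests. For $G$ transient, $\mathsf{WSF}$ is the unique probability measure on oriented subgraphs of $G$ such that for every finite set $B$ of oriented edges, $\mathsf{WSF}[B\subseteq F]=\lim_{R\to\infty}\mathsf{USF}(Z_R)[B\subseteq F_R]$, where $F\sim\mathsf{WSF}$, $F_R\sim\mathsf{USF}(Z_R)$, and $Z_0\supseteq Z_1\supseteq\cdots$ are subsets of $V$ with each $V\setminus Z_R$ finite and $\bigcap_R Z_R=\varnothing$; the limit exists and does not depend on the choice of $(Z_R)$. A forest $F$ in which each vertex has outdegree $1$ is identified with the rotor configuration sending $x$ to its out-neighbor in $F$. Ends. An end of a tree is an equivalence class of infinite (simple) paths, two paths being equivalent if they differ by only finitely many vertices. *)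

theory Defs
  imports "HOL-Probability.Probability"
begin

text \<open>
  The vertex set is the whole type \<open>'v\<close>. An undirected graph is given by the symmetric relation
  \<open>E\<close> of its oriented edges; the neighbour set \<open>N(x)\<close> is \<open>E `` {x}\<close>.
\<close>

definition simple_graph :: "('v \<times> 'v) set \<Rightarrow> bool" where
  "simple_graph E \<longleftrightarrow> sym E \<and> irrefl E"

definition connected_graph :: "('v \<times> 'v) set \<Rightarrow> bool" where
  "connected_graph E \<longleftrightarrow> (\<forall>x y. (x, y) \<in> E\<^sup>*)"

definition locally_finite :: "('v \<times> 'v) set \<Rightarrow> bool" where
  "locally_finite E \<longleftrightarrow> (\<forall>x. finite (E `` {x}))"

text \<open>Number of visits, infinite if there are infinitely many; time 0 is counted.\<close>

definition visits :: "(nat \<Rightarrow> 'v) \<Rightarrow> 'v \<Rightarrow> ennreal" where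
  "visits X x = emeasure (count_space UNIV) {t. X t = x}"


section \<open>Simple random walk\<close>

text \<open>
  The walk is realised on the space of families of independent instructions \<open>\<omega> (t, x)\<close>,
  uniform on the neighbours of \<open>x\<close>: the walker that is at \<open>x\<close> at time \<open>t\<close> moves to \<open>\<omega> (t, x)\<close>.
  Every instruction is used at most once, so that the walk is the Markov chain that
  moves from \<open>x\<close> to each neighbour of \<open>x\<close> with probability \<open>1 / deg x\<close>.
\<close>

definition srw_space :: "('v \<times> 'v) set \<Rightarrow> (nat \<times> 'v \<Rightarrow> 'v) measure" where
  "srw_space E = (\<Pi>\<^sub>M tx\<in>UNIV. measure_pmf (pmf_of_set (E `` {snd tx})))"

primrec srw :: "'v \<Rightarrow> (nat \<times> 'v \<Rightarrow> 'v) \<Rightarrow> nat \<Rightarrow> 'v" where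
  "srw a \<omega> 0 = a"
| "srw a \<omega> (Suc t) = \<omega> (t, srw a \<omega> t)"

definition transient :: "('v \<times> 'v) set \<Rightarrow> bool" where
  "transient E \<longleftrightarrow>
     (\<forall>v. measure (srw_space E) {\<omega> \<in> space (srw_space E). \<exists>t>0. srw v \<omega> t = v} < 1)"

definition green :: "('v \<times> 'v) set \<Rightarrow> 'v \<Rightarrow> 'v \<Rightarrow> ennreal" where
  "green E a x = (\<integral>\<^sup>+ \<omega>. visits (srw a \<omega>) x \<partial>srw_space E)"


section \<open>Rotor walk\<close>

definition local_mechanism :: "('v \<times> 'v) set \<Rightarrow> 'v \<Rightarrow> ('v \<Rightarrow> 'v) \<Rightarrow> bool" where
  "local_mechanism E x \<sigma> \<longleftrightarrow>
     bij_betw \<sigma> (E `` {x}) (E `` {x}) \<and>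
     (\<forall>y \<in> E `` {x}. {(\<sigma> ^^ i) y | i. True} = E `` {x})"

fun rotor_step :: "('v \<Rightarrow> 'v \<Rightarrow> 'v) \<Rightarrow> 'v \<times> ('v \<Rightarrow> 'v) \<Rightarrow> 'v \<times> ('v \<Rightarrow> 'v)" where
  "rotor_step \<tau> (x, \<rho>) = (\<tau> x (\<rho> x), \<rho>(x := \<tau> x (\<rho> x)))"

definition rotor_walk :: "('v \<Rightarrow> 'v \<Rightarrow> 'v) \<Rightarrow> 'v \<Rightarrow> ('v \<Rightarrow> 'v) \<Rightarrow> nat \<Rightarrow> 'v" where
  "rotor_walk \<tau> a \<rho> t = fst ((rotor_step \<tau> ^^ t) (a, \<rho>))"


section \<open>Spanning forests\<close>

text \<open>Oriented subgraphs are spanning and hence identified with their sets of oriented edges.\<close>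

definition oriented_forest :: "('v \<times> 'v) set \<Rightarrow> 'v set \<Rightarrow> ('v \<times> 'v) set \<Rightarrow> bool" where
  "oriented_forest E Z F \<longleftrightarrow>
     F \<subseteq> E \<and> (\<forall>x\<in>Z. F `` {x} = {}) \<and> (\<forall>x. x \<notin> Z \<longrightarrow> (\<exists>!y. (x, y) \<in> F)) \<and> acyclic F"

text \<open>Only meaningful if \<open>- Z\<close> is finite.\<close>

definition USF :: "('v \<times> 'v) set \<Rightarrow> 'v set \<Rightarrow> ('v \<times> 'v) set pmf" where
  "USF E Z = pmf_of_set {F. oriented_forest E Z F}"

definition subgraph_space :: "('v \<times> 'v) set \<Rightarrow> ('v \<times> 'v) set measure" where
  "subgraph_space E = sigma (Pow E) {{F. F \<subseteq> E \<and> e \<in> F} | e. e \<in> E}"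

definition exhausting :: "(nat \<Rightarrow> 'v set) \<Rightarrow> bool" where
  "exhausting Z \<longleftrightarrow> decseq Z \<and> (\<forall>R. finite (- Z R)) \<and> (\<Inter>R. Z R) = {}"

text \<open>
  The defining property of the wired spanning forest oriented toward infinity. The sets
  \<open>{F. B \<subseteq> F}\<close> with \<open>B\<close> finite form an intersection-stable generator, so at most one measure
  has this property (if \<open>E\<close> is connected and locally finite, so that there is some \<open>Z\<close>).
\<close>

definition wired_spanning_forest :: "('v \<times> 'v) set \<Rightarrow> ('v \<times> 'v) set measure \<Rightarrow> bool" where
  "wired_spanning_forest E W \<longleftrightarrow>
     prob_space W \<and> sets W = sets (subgraph_space E) \<and>
     (\<forall>B Z. finite B \<and> B \<subseteq> E \<and> exhausting Z \<longrightarrow>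
        (\<lambda>R. measure_pmf.prob (USF E (Z R)) {F. B \<subseteq> F})
          \<longlonglongrightarrow> measure W {F \<in> space W. B \<subseteq> F})"

text \<open>The rotor configuration identified with a forest in which every vertex has outdegree 1.\<close>

definition rotor_of :: "('v \<times> 'v) set \<Rightarrow> 'v \<Rightarrow> 'v" where
  "rotor_of F x = (THE y. (x, y) \<in> F)"


section \<open>Ends\<close>

definition unoriented :: "('v \<times> 'v) set \<Rightarrow> ('v \<times> 'v) set" where
  "unoriented F = F \<union> F\<inverse>"

definition components :: "('v \<times> 'v) set \<Rightarrow> 'v set set" where
  "components F = UNIV // (unoriented F)\<^sup>*"

definition rays :: "('v \<times> 'v) set \<Rightarrow> 'v set \<Rightarrow> (nat \<Rightarrow> 'v) set" where
  "rays F C = {p. inj p \<and> range p \<subseteq> C \<and> (\<forall>n. (p n, p (Suc n)) \<in> unoriented F)}"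

text \<open>Equivalent rays differ by only finitely many vertices.\<close>

definition ends :: "('v \<times> 'v) set \<Rightarrow> 'v set \<Rightarrow> (nat \<Rightarrow> 'v) set set" where
  "ends F C = rays F C //
     {(p, q). p \<in> rays F C \<and> q \<in> rays F C \<and>
        finite ((range p - range q) \<union> (range q - range p))}"

end

theory Submission
  imports Defs
begin

text \<open>
  Let \<open>Z\<close> have finite complement. Away from its current location \<open>x\<close>, the rotors of the walk killed at \<open>Z\<close>
  that starts at \<open>a\<close> from a \<open>Z\<close>-oriented forest always form a forest rooted at \<open>insert x Z\<close> with \<open>a\<close> in the
  tree of \<open>x\<close>, and every such state is visited exactly once, from exactly one initial forest. Hence the
  expected number of visits to \<open>x\<close> under \<open>USF Z\<close> is \<open>deg x\<close> times a quotient of forest counts, and this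
  quotient is shown to be the Green function of the killed random walk by checking that it solves the same
  linear equations. By locality of the killed walk this gives the upper bound under the infinite-volume measure.

  For the lower bound, a visit to \<open>x\<close> after the walk has left a large finite set corresponds to a forest in
  which the tree of the root \<open>x\<close> reaches far away. If that tree contains a fixed vertex \<open>w0\<close>
  with small Green function, this is rare. Otherwise moving the root along a path towards \<open>w0\<close> until it can be
  attached to the rest produces a \<open>Z\<close>-oriented forest in which some vertex near \<open>x\<close> has a large past, which is
  rare because one-endedness makes all pasts finite.
\<close>

section \<open>Counting forests\<close>

text \<open>The number of visits is not a local function of the forest, since a visit may follow an
  excursion of any length. Convergence of \<open>USF\<close> on finitely many edges therefore does
  not carry its mean to the limit. Killing at \<open>Z R\<close> makes the count local; what has to
  be excluded is that walks killed only at \<open>Z R'\<close>, with \<open>R'\<close> far beyond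
  \<open>R\<close>, still gain a positive mean number of visits after touching \<open>Z R\<close>.
  Throughout, \<open>R'\<close> tends to infinity while \<open>R\<close> is fixed. A union bound
  over far vertices \<open>w\<close> fails: each single \<open>w\<close> is controlled by the Green
  function from \<open>w\<close> to \<open>x\<close>, but nothing controls the sum. Hence the Green
  function is spent on one vertex \<open>w0\<close> only. It exists because the mean of the Green
  function over the position at time \<open>n\<close> is the tail of a convergent series. Moving the
  root costs a degree factor for each edge of the path. The path from \<open>x\<close> to
  \<open>w0\<close> is fixed before \<open>R\<close>, so these factors are constants; and since
  \<open>w0\<close> is outside the tree, the path has to leave it.\<close>

locale lgraph =
  fixes E :: "('v \<times> 'v) set"
  assumes symE: "sym E" and irreflE: "irrefl E"
    and conn: "\<And>x y. (x, y) \<in> E\<^sup>*"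
    and finite_nbrs [simp]: "\<And>x. finite (E `` {x})"
    and nbrs_nonempty [simp]: "\<And>x. E `` {x} \<noteq> {}"
begin

abbreviation deg :: "'v \<Rightarrow> nat" where "deg x \<equiv> card (E `` {x})"

abbreviation forests :: "'v set \<Rightarrow> ('v \<times> 'v) set set" where
  "forests Z \<equiv> {F. oriented_forest E Z F}"

lemma deg_pos [simp]: "0 < deg x"
  by (simp add: card_gt_0_iff)

lemma edge_sym: "(x, y) \<in> E \<longleftrightarrow> (y, x) \<in> E"
  using symE by (auto dest: symD)

lemma edge_irrefl [simp]: "(x, x) \<notin> E"
  using irreflE by (auto simp: irrefl_def)

lemma finite_edges_from: "finite D \<Longrightarrow> finite (E \<inter> D \<times> UNIV)"
  by (rule finite_subset[of _ "Sigma D (\<lambda>x. E `` {x})"]) (auto intro!: finite_SigmaI)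

lemma forest_subset: "oriented_forest E Z F \<Longrightarrow> F \<subseteq> E \<inter> (- Z) \<times> UNIV"
  by (auto simp: oriented_forest_def)

lemma finite_forests:
  assumes "finite (- Z)"
  shows "finite (forests Z)"
proof (rule finite_subset)
  show "forests Z \<subseteq> Pow (E \<inter> (- Z) \<times> UNIV)"
    using forest_subset by blast
  show "finite (Pow (E \<inter> (- Z) \<times> UNIV))"
    using finite_edges_from[OF assms] by (rule finite_Pow_iff[THEN iffD2])
qed

lemma forest_single_valued: "oriented_forest E Z F \<Longrightarrow> single_valued F"
  unfolding oriented_forest_def single_valued_def by (metis Image_singleton_iff empty_iff)

section \<open>Adding and deleting the out-edge of a vertex\<close>

lemma forest_insert:
  assumes "oriented_forest E (insert w Y) F" "w \<notin> Y" "(w, v) \<in> E" "(v, w) \<notin> F\<^sup>*"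
  shows "oriented_forest E Y (insert (w, v) F)"
  using assms unfolding oriented_forest_def by (auto simp: acyclic_insert)

lemma forest_remove:
  assumes "oriented_forest E Y F" "w \<notin> Y"
  shows "oriented_forest E (insert w Y) (F - {w} \<times> UNIV)"
  using assms acyclic_subset[of F "F - {w} \<times> UNIV"] unfolding oriented_forest_def
  by auto

text \<open>Cut the path at its first visit to \<open>y\<close>: before that, no edge out of
  \<open>y\<close> is used. Deleting these edges is how a vertex is turned into a root, so this
  tells which root is reached afterwards.\<close>

lemma rtrancl_avoid:
  assumes "(u, x) \<in> R\<^sup>*"
  shows "(u, x) \<in> (R - {y} \<times> UNIV)\<^sup>* \<or> (u, y) \<in> (R - {y} \<times> UNIV)\<^sup>*"
  using assms
proof (induction rule: converse_rtrancl_induct)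
  case (step u v)
  show ?case
  proof (cases "u = y")
    case False
    then have "(u, v) \<in> R - {y} \<times> UNIV" using step by auto
    then show ?thesis using step.IH by (meson converse_rtrancl_into_rtrancl)
  qed auto
qed auto

lemma rtrancl_avoid_target:
  "(u, y) \<in> R\<^sup>* \<Longrightarrow> (u, y) \<in> (R - {y} \<times> UNIV)\<^sup>*"
  using rtrancl_avoid[of u y R y] by simp

lemma rtrancl_insert_edge_unreaching:
  assumes "(v, w) \<notin> F\<^sup>*"
  shows "(v, x) \<in> (insert (w, u) F)\<^sup>* \<longleftrightarrow> (v, x) \<in> F\<^sup>*"
  using assms by (auto simp: rtrancl_insert)

lemma rtrancl_from_sink:
  "F `` {w} = {} \<Longrightarrow> (w, x) \<in> F\<^sup>* \<longleftrightarrow> x = w"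
  by (metis Image_singleton_iff converse_rtranclE empty_iff rtrancl.rtrancl_refl)

lemma single_valued_path_linear:
  assumes "single_valued R" "(a, x) \<in> R\<^sup>*" "(a, y) \<in> R\<^sup>*"
  shows "(x, y) \<in> R\<^sup>* \<or> (y, x) \<in> R\<^sup>*"
  using assms by (rule single_valued_confluent)

text \<open>Split off the out-edge of \<open>w\<close>. It may end at any neighbour outside the tree
  of \<open>w\<close>; one inside would close a cycle.\<close>

lemma sum_forests_insert:
  fixes f :: "('v \<times> 'v) set \<Rightarrow> 'b::comm_monoid_add"
  assumes fin: "finite (- Y)" and w: "w \<notin> Y"
  shows "(\<Sum>F\<in>forests Y. f F) =
    (\<Sum>F\<in>forests (insert w Y). \<Sum>v\<in>{v \<in> E `` {w}. (v, w) \<notin> F\<^sup>*}. f (insert (w, v) F))"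
proof -
  let ?P = "Sigma (forests (insert w Y)) (\<lambda>F. {v \<in> E `` {w}. (v, w) \<notin> F\<^sup>*})"
  have fin': "finite (forests (insert w Y))"
    by (rule finite_forests) (use fin in \<open>auto intro: finite_subset\<close>)
  have nw: "(w, u) \<notin> F" if "oriented_forest E (insert w Y) F" for F u
    using that by (auto simp: oriented_forest_def)
  have "(\<Sum>F\<in>forests Y. f F) = (\<Sum>(F, v)\<in>?P. f (insert (w, v) F))"
  proof (rule sum.reindex_bij_witness[where
        i = "\<lambda>(F, v). insert (w, v) F" and j = "\<lambda>F. (F - {w} \<times> UNIV, THE v. (w, v) \<in> F)"])
    fix F assume "F \<in> forests Y"
    then have F: "oriented_forest E Y F" by simp
    then obtain v where v: "(w, v) \<in> F" and uniq: "\<And>v'. (w, v') \<in> F \<Longrightarrow> v' = v"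
      using w unfolding oriented_forest_def by blast
    have the: "(THE v. (w, v) \<in> F) = v"
      using v uniq by blast
    have ins: "insert (w, v) (F - {w} \<times> UNIV) = F"
      using v uniq by blast
    then show "(\<lambda>(F, v). insert (w, v) F) (F - {w} \<times> UNIV, THE v. (w, v) \<in> F) = F"
      by (simp only: the prod.case)
    have "(v, w) \<notin> (F - {w} \<times> UNIV)\<^sup>*"
      using F ins unfolding oriented_forest_def by (metis acyclic_insert)
    moreover have "(w, v) \<in> E" using v F by (auto simp: oriented_forest_def)
    ultimately show "(F - {w} \<times> UNIV, THE v. (w, v) \<in> F) \<in> ?P"
      using forest_remove[OF F w] by (simp add: the)
    show "(case (F - {w} \<times> UNIV, THE v. (w, v) \<in> F) of (F, v) \<Rightarrow> f (insert (w, v) F)) = f F"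
      by (simp only: the ins prod.case)
  next
    fix p assume p: "p \<in> ?P"
    obtain F v where [simp]: "p = (F, v)" by (cases p)
    have F: "oriented_forest E (insert w Y) F" "(w, v) \<in> E" "(v, w) \<notin> F\<^sup>*"
      using p by auto
    show "(case p of (F, v) \<Rightarrow> insert (w, v) F) \<in> forests Y"
      using forest_insert[OF F(1) w F(2,3)] by simp
    have "(THE u. (w, u) \<in> insert (w, v) F) = v"
      using nw[OF F(1)] by auto
    moreover have "insert (w, v) F - {w} \<times> UNIV = F"
      using nw[OF F(1)] by auto
    ultimately show "((case p of (F, v) \<Rightarrow> insert (w, v) F) - {w} \<times> UNIV,
        THE u. (w, u) \<in> (case p of (F, v) \<Rightarrow> insert (w, v) F)) = p"
      by simp
  qed
  also have "\<dots> = (\<Sum>F\<in>forests (insert w Y). \<Sum>v\<in>{v \<in> E `` {w}. (v, w) \<notin> F\<^sup>*}. f (insert (w, v) F))"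
    by (rule sum.Sigma[symmetric]) (auto simp: fin' intro: finite_subset[of _ "E `` {w}"])
  finally show ?thesis .
qed

section \<open>The discrete Laplace equation for forest counts\<close>

definition linked :: "'v set \<Rightarrow> 'v \<Rightarrow> 'v \<Rightarrow> real" where
  "linked Z x w = (\<Sum>F\<in>forests (insert x Z). of_bool ((w, x) \<in> F\<^sup>*))"

lemma linked_nonneg: "0 \<le> linked Z x w"
  unfolding linked_def by (intro sum_nonneg) auto

lemma linked_eq_0:
  assumes "w \<in> Z" "x \<notin> Z" shows "linked Z x w = 0"
  unfolding linked_def
proof (rule sum.neutral, intro ballI)
  fix F assume "F \<in> forests (insert x Z)"
  then have "F `` {w} = {}" using assms by (auto simp: oriented_forest_def)
  then show "of_bool ((w, x) \<in> F\<^sup>*) = 0"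
    using assms rtrancl_from_sink[of F w x] by auto
qed

lemma linked_card:
  assumes "finite (- Z)"
  shows "linked Z x w = card {F \<in> forests (insert x Z). (w, x) \<in> F\<^sup>*}"
proof -
  have "finite (forests (insert x Z))"
    by (rule finite_forests) (use assms in \<open>auto intro: finite_subset\<close>)
  then show ?thesis by (simp add: linked_def of_bool_def sum.If_cases Int_def)
qed

text \<open>The out-edge of \<open>x\<close> may point to exactly the neighbours outside the tree of
  \<open>x\<close>, and \<open>linked Z x x\<close> counts all forests rooted at
  \<open>insert x Z\<close>. This is the Laplace equation at the pole.\<close>

lemma card_forests_linked:
  assumes "finite (- Z)" "x \<notin> Z"
  shows "real (card (forests Z)) = (\<Sum>y\<in>E `` {x}. linked Z x x - linked Z x y)"
proof -
  have "real (card (forests Z)) = (\<Sum>F\<in>forests Z. 1)" by simp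
  also have "\<dots> = (\<Sum>F\<in>forests (insert x Z). \<Sum>y\<in>{y \<in> E `` {x}. (y, x) \<notin> F\<^sup>*}. 1)"
    by (rule sum_forests_insert[OF assms])
  also have "\<dots> = (\<Sum>F\<in>forests (insert x Z). \<Sum>y\<in>E `` {x}. 1 - of_bool ((y, x) \<in> F\<^sup>*))"
  proof (rule sum.cong[OF refl])
    fix F assume "F \<in> forests (insert x Z)"
    have "(\<Sum>y\<in>E `` {x}. 1 - of_bool ((y, x) \<in> F\<^sup>*) :: real)
        = (\<Sum>y\<in>{y \<in> E `` {x}. (y, x) \<notin> F\<^sup>*}. 1 - of_bool ((y, x) \<in> F\<^sup>*))"
      by (rule sum.mono_neutral_right) auto
    then show "(\<Sum>y\<in>{y \<in> E `` {x}. (y, x) \<notin> F\<^sup>*}. 1) = (\<Sum>y\<in>E `` {x}. 1 - of_bool ((y, x) \<in> F\<^sup>*) :: real)"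
      by simp
  qed
  also have "\<dots> = (\<Sum>y\<in>E `` {x}. \<Sum>F\<in>forests (insert x Z). 1 - of_bool ((y, x) \<in> F\<^sup>*))"
    by (rule sum.swap)
  finally show ?thesis
    by (simp add: linked_def sum_subtractf)
qed

text \<open>Cut the out-edge of \<open>w\<close> and fix the remaining forest \<open>F\<close>. For
  an admissible end \<open>v\<close> of that edge, neighbours in other trees keep their status,
  while neighbours in the tree of \<open>w\<close> inherit that of \<open>v\<close>. Summed over
  \<open>v\<close>, both sides become \<open>deg w\<close> times the number of admissible neighbours
  linked to \<open>x\<close>, so the identity holds for each \<open>F\<close> separately.\<close>

lemma linked_harmonic:
  assumes fin: "finite (- Z)" and w: "w \<notin> Z" "w \<noteq> x"
  shows "real (deg w) * linked Z x w = (\<Sum>y\<in>E `` {w}. linked Z x y)"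
proof -
  let ?Y = "insert x Z"
  define b where "b F y = (of_bool ((y, x) \<in> F\<^sup>*) :: real)" for F y
  let ?A = "\<lambda>F. {v \<in> E `` {w}. (v, w) \<notin> F\<^sup>*}"
  have finY: "finite (- ?Y)" using fin by (auto intro: finite_subset)
  have wY: "w \<notin> ?Y" using w by auto
  have b_w: "b (insert (w, v) F) w = b F v"
    if "v \<in> ?A F" "oriented_forest E (insert w ?Y) F" for F v
  proof -
    have "F `` {w} = {}" using that by (auto simp: oriented_forest_def)
    then have "(w, x) \<notin> F\<^sup>*" using rtrancl_from_sink w by metis
    then show ?thesis by (auto simp: b_def rtrancl_insert)
  qed
  have b_A: "b (insert (w, v) F) y = b F y" if "y \<in> ?A F" for F v y
    using that rtrancl_insert_edge_unreaching[of y w F x v] by (simp add: b_def)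
  have b_nA: "b (insert (w, v) F) y = b F v"
    if "v \<in> ?A F" "(y, w) \<in> F\<^sup>*" "oriented_forest E (insert w ?Y) F" for F v y
  proof -
    have "F `` {w} = {}" using that by (auto simp: oriented_forest_def)
    \<comment> \<open>\<open>w\<close> and \<open>x\<close> are distinct roots of \<open>F\<close>,
      and a vertex leads to one root only.\<close>
    have "(y, x) \<notin> F\<^sup>*"
    proof
      assume "(y, x) \<in> F\<^sup>*"
      then have "(x, w) \<in> F\<^sup>* \<or> (w, x) \<in> F\<^sup>*"
        using single_valued_path_linear forest_single_valued that by metis
      moreover have "F `` {x} = {}" using that by (auto simp: oriented_forest_def)
      ultimately show False
        using rtrancl_from_sink \<open>F `` {w} = {}\<close> w by metis
    qed
    then show ?thesis using that by (auto simp: b_def rtrancl_insert)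
  qed
  have "real (deg w) * linked Z x w = (\<Sum>F\<in>forests ?Y. real (deg w) * b F w)"
    by (simp add: linked_def b_def sum_distrib_left)
  also have "\<dots> = (\<Sum>F\<in>forests (insert w ?Y). \<Sum>v\<in>?A F. real (deg w) * b (insert (w, v) F) w)"
    by (rule sum_forests_insert[OF finY wY])
  also have "\<dots> = (\<Sum>F\<in>forests (insert w ?Y). \<Sum>v\<in>?A F. \<Sum>y\<in>E `` {w}. b (insert (w, v) F) y)"
  proof (rule sum.cong[OF refl])
    fix F assume "F \<in> forests (insert w ?Y)"
    then have F: "oriented_forest E (insert w ?Y) F" by simp
    let ?B = "E `` {w} - ?A F"
    have fA: "finite (?A F)" by (rule finite_subset[of _ "E `` {w}"]) auto
    have "card (?A F) \<le> deg w" by (rule card_mono) auto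
    moreover have "card ?B = deg w - card (?A F)" by (rule card_Diff_subset) (use fA in auto)
    ultimately have card: "card (?A F) + card ?B = deg w" by simp
    have split: "(\<Sum>y\<in>E `` {w}. b (insert (w, v) F) y) = (\<Sum>y\<in>?A F. b F y) + card ?B * b F v"
      if "v \<in> ?A F" for v
    proof -
      have "(\<Sum>y\<in>E `` {w}. b (insert (w, v) F) y)
          = (\<Sum>y\<in>?B. b (insert (w, v) F) y) + (\<Sum>y\<in>?A F. b (insert (w, v) F) y)"
        by (rule sum.subset_diff) auto
      also have "(\<Sum>y\<in>?B. b (insert (w, v) F) y) = (\<Sum>y\<in>?B. b F v)"
        by (rule sum.cong[OF refl], rule b_nA) (use that F in auto)
      also have "(\<Sum>y\<in>?A F. b (insert (w, v) F) y) = (\<Sum>y\<in>?A F. b F y)"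
        by (rule sum.cong[OF refl], rule b_A)
      finally show ?thesis by simp
    qed
    have "(\<Sum>v\<in>?A F. \<Sum>y\<in>E `` {w}. b (insert (w, v) F) y)
        = (\<Sum>v\<in>?A F. (\<Sum>y\<in>?A F. b F y) + card ?B * b F v)"
      by (rule sum.cong[OF refl], rule split)
    also have "\<dots> = (card (?A F) + card ?B) * (\<Sum>y\<in>?A F. b F y)"
      by (simp add: sum.distrib sum_distrib_left[symmetric] ring_distribs)
    also have "\<dots> = (\<Sum>v\<in>?A F. real (deg w) * b F v)"
      unfolding card by (simp add: sum_distrib_left)
    also have "\<dots> = (\<Sum>v\<in>?A F. real (deg w) * b (insert (w, v) F) w)"
      by (rule sum.cong[OF refl]) (simp add: b_w F)
    finally show "(\<Sum>v\<in>?A F. real (deg w) * b (insert (w, v) F) w)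
        = (\<Sum>v\<in>?A F. \<Sum>y\<in>E `` {w}. b (insert (w, v) F) y)" by simp
  qed
  also have "\<dots> = (\<Sum>F\<in>forests ?Y. \<Sum>y\<in>E `` {w}. b F y)"
    by (rule sum_forests_insert[OF finY wY, symmetric])
  also have "\<dots> = (\<Sum>y\<in>E `` {w}. linked Z x y)"
    unfolding linked_def b_def by (rule sum.swap)
  finally show ?thesis .
qed

lemma boundary_edge:
  assumes "x \<notin> Z" "z \<in> Z"
  obtains u v where "u \<notin> Z" "v \<in> Z" "(u, v) \<in> E"
proof -
  have "(x, z) \<in> E\<^sup>*" by (rule conn)
  then have "\<exists>u v. u \<notin> Z \<and> v \<in> Z \<and> (u, v) \<in> E"
    using assms(1) by (induction rule: converse_rtrancl_induct) (use assms in auto)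
  then show ?thesis using that by blast
qed

text \<open>Induction on the number of non-roots: a vertex \<open>u\<close> with a neighbour
  \<open>v\<close> in \<open>Z\<close> is made a root, and its edge to \<open>v\<close> is added
  afterwards. As \<open>v\<close> has no out-edge, no cycle arises.\<close>

lemma forests_nonempty:
  assumes "finite (- Z)" "Z \<noteq> {}"
  shows "forests Z \<noteq> {}"
  using assms
proof (induction "card (- Z)" arbitrary: Z)
  case 0
  then have "Z = UNIV" by auto
  then have "{} \<in> forests Z" by (auto simp: oriented_forest_def acyclic_def)
  then show ?case by blast
next
  case (Suc n)
  then obtain x where "x \<notin> Z" by (metis Compl_UNIV_eq Suc_neq_Zero UNIV_eq_I card.empty)
  moreover obtain z where "z \<in> Z" using Suc by blast
  ultimately obtain u v where uv: "u \<notin> Z" "v \<in> Z" "(u, v) \<in> E" using boundary_edge by metis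
  have "- insert u Z = - Z - {u}" by auto
  then have "card (- insert u Z) = n" "finite (- insert u Z)"
    using Suc uv by auto
  then have "forests (insert u Z) \<noteq> {}" using Suc by auto
  then obtain F where F: "oriented_forest E (insert u Z) F" by blast
  then have "F `` {v} = {}" using uv by (auto simp: oriented_forest_def)
  then have "(v, u) \<notin> F\<^sup>*" using rtrancl_from_sink uv by metis
  from forest_insert[OF F uv(1,3) this] show ?case by blast
qed

end

section \<open>The transition probabilities of the simple random walk\<close>

context lgraph begin

lemma countable_vertices: "countable (UNIV :: 'v set)"
proof -
  fix x :: 'v
  have fin: "finite ((E ^^ n) `` {x})" for n
  proof (induction n)
    case (Suc n)
    have "(E ^^ Suc n) `` {x} = (\<Union>y\<in>(E ^^ n) `` {x}. E `` {y})" by auto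
    then show ?case using Suc by simp
  qed simp
  have "(UNIV :: 'v set) = (\<Union>n. (E ^^ n) `` {x})"
    using conn[of x] by (auto simp: rtrancl_power)
  then show ?thesis
    using fin by (metis countableI_type countable_UN countable_finite)
qed

abbreviation W :: "(nat \<times> 'v \<Rightarrow> 'v) measure" where "W \<equiv> srw_space E"

lemma space_srw [simp]: "space W = UNIV"
  by (simp add: srw_space_def space_PiM)

lemma product_prob_srw: "product_prob_space (\<lambda>tx :: nat \<times> 'v. measure_pmf (pmf_of_set (E `` {snd tx})))"
  by (intro product_prob_spaceI) (rule prob_space_measure_pmf)

lemma prob_space_srw: "prob_space W"
  unfolding srw_space_def by (intro prob_space_PiM prob_space_measure_pmf)

sublocale srw: prob_space "srw_space E"
  by (rule prob_space_srw)

lemma instruction_measurable: "(\<lambda>\<omega>. \<omega> i) \<in> W \<rightarrow>\<^sub>M count_space UNIV"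
proof -
  have "(\<lambda>\<omega>. \<omega> i) \<in> W \<rightarrow>\<^sub>M measure_pmf (pmf_of_set (E `` {snd i}))"
    unfolding srw_space_def by (rule measurable_component_singleton) simp
  then show ?thesis by (simp cong: measurable_cong_sets)
qed

lemma instruction_event: "{\<omega>. \<omega> i = y} \<in> srw.events"
  using measurable_sets[OF instruction_measurable, of "{y}" i] by (simp add: vimage_def)

lemma srw_measurable [measurable]: "(\<lambda>\<omega>. srw v \<omega> t) \<in> W \<rightarrow>\<^sub>M count_space UNIV"
proof (induction t)
  case (Suc t)
  show ?case
    unfolding srw.simps
    by (rule measurable_compose_countable'[OF _ Suc countable_vertices]) (rule instruction_measurable)
qed simp

lemma srw_event: "{\<omega>. P (srw v \<omega> t)} \<in> srw.events"
  using measurable_sets[OF srw_measurable, of "{x. P x}" v t] by (simp add: vimage_def)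

lemma srw_between_event: "{\<omega>. \<forall>s. 0 < s \<and> s < t \<longrightarrow> srw v \<omega> s \<in> A} \<in> srw.events"
proof -
  have "{\<omega> \<in> space W. \<forall>s. 0 < s \<and> s < t \<longrightarrow> srw v \<omega> s \<in> A} \<in> srw.events"
    by (rule sets.sets_Collect_countable_All)
       (use srw_event[of "\<lambda>z. 0 < s \<and> s < t \<longrightarrow> z \<in> A" v s for s] in simp)
  then show ?thesis by simp
qed

lemma AE_instruction: "AE \<omega> in W. \<omega> (t, y) \<in> E `` {y}"
proof -
  interpret P: product_prob_space "\<lambda>tx :: nat \<times> 'v. measure_pmf (pmf_of_set (E `` {snd tx}))" UNIV
    by (rule product_prob_srw)
  have "AE x in measure_pmf (pmf_of_set (E `` {snd (t, y)})). x \<in> E `` {y}"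
    by (simp add: AE_measure_pmf_iff)
  from P.AE_component[OF _ this] show ?thesis
    unfolding srw_space_def by simp
qed

lemma AE_instructions: "AE \<omega> in W. \<forall>y. \<omega> (t, y) \<in> E `` {y}"
  using AE_ball_countable[OF countable_vertices, of "\<lambda>\<omega> y. \<omega> (t, y) \<in> E `` {y}"] AE_instruction by simp

section \<open>Laws of the instructions and of the walk\<close>

lemma prob_instructions:
  assumes "finite J"
  shows "srw.prob {\<omega>. \<forall>i\<in>J. \<omega> i = c i} = (\<Prod>i\<in>J. pmf (pmf_of_set (E `` {snd i})) (c i))"
proof -
  interpret P: product_prob_space "\<lambda>tx :: nat \<times> 'v. measure_pmf (pmf_of_set (E `` {snd tx}))" UNIV
    by (rule product_prob_srw)
  have "emeasure W {\<omega>. \<forall>i\<in>J. \<omega> i = c i} =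
      (\<Prod>i\<in>J. emeasure (measure_pmf (pmf_of_set (E `` {snd i}))) {c i})"
    using P.emeasure_PiM_Collect[OF _ assms, of "\<lambda>i. {c i}"]
    unfolding srw_space_def[symmetric] by simp
  then show ?thesis
    by (simp add: srw.emeasure_eq_measure emeasure_pmf_single prod_ennreal prod_nonneg)
qed

text \<open>The probability of going from \<open>v\<close> to \<open>x\<close> in \<open>t\<close>
  steps with all intermediate positions in \<open>A\<close>; the test \<open>t = 0\<close> exempts
  the starting point. For \<open>A = - {v}\<close> and \<open>x = v\<close> it is the first-return
  law, for \<open>A = UNIV\<close> the transition probability.\<close>

primrec taboo :: "'v set \<Rightarrow> 'v \<Rightarrow> nat \<Rightarrow> 'v \<Rightarrow> real" where
  "taboo A v 0 x = of_bool (v = x)"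
| "taboo A v (Suc t) x = (\<Sum>y\<in>E `` {x}. if t = 0 \<or> y \<in> A then taboo A v t y / deg y else 0)"

lemma taboo_nonneg: "0 \<le> taboo A v t x"
  by (induction t arbitrary: x) (auto intro!: sum_nonneg)

text \<open>Prescribing in addition finitely many instructions for the time from \<open>t\<close> on makes the induction work.\<close>

lemma prob_taboo_instructions:
  assumes "finite J" "\<And>s y. (s, y) \<in> J \<Longrightarrow> t \<le> s"
  shows "srw.prob {\<omega>. srw v \<omega> t = x \<and> (\<forall>s. 0 < s \<and> s < t \<longrightarrow> srw v \<omega> s \<in> A) \<and> (\<forall>i\<in>J. \<omega> i = c i)}
       = taboo A v t x * (\<Prod>i\<in>J. pmf (pmf_of_set (E `` {snd i})) (c i))"
  using assms
proof (induction t arbitrary: x J c)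
  case 0
  then show ?case by (cases "v = x") (simp_all add: prob_instructions)
next
  case (Suc t)
  \<comment> \<open>The last step, from \<open>y\<close> at time \<open>t\<close>, becomes one more
    prescribed instruction. It is not in \<open>J\<close>, whose times are at least
    \<open>Suc t\<close>, and the induction hypothesis at time \<open>t\<close> admits it.\<close>
  let ?c = "\<lambda>y. c((t, y) := x)" and ?J = "\<lambda>y. insert (t, y) J"
  define S where "S y = {\<omega>. srw v \<omega> t = y \<and> (\<forall>s. 0 < s \<and> s < t \<longrightarrow> srw v \<omega> s \<in> A) \<and> (\<forall>i\<in>?J y. \<omega> i = ?c y i)}" for y
  let ?B = "{y \<in> E `` {x}. t = 0 \<or> y \<in> A}"
  have finB: "finite ?B" by (rule finite_subset[of _ "E `` {x}"]) auto
  have nJ: "(t, y) \<notin> J" for y using Suc.prems(2) by force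
  have evJ: "{\<omega>. \<forall>i\<in>J. \<omega> i = c i} \<in> srw.events" if "finite J" for J c
    using sets.sets_Collect_finite_All[of J W "\<lambda>i \<omega>. \<omega> i = c i"] that instruction_event by simp
  have ev: "{\<omega>. srw v \<omega> t = y \<and> (\<forall>s. 0 < s \<and> s < t \<longrightarrow> srw v \<omega> s \<in> A) \<and> (\<forall>i\<in>J. \<omega> i = c i)} \<in> srw.events"
    if "finite J" for t y J c
    using sets.Int[OF srw_event[of "\<lambda>z. z = y" v t] sets.Int[OF srw_between_event evJ[OF that]]]
    by (simp add: Int_def)
  have S_ev: "S y \<in> srw.events" for y
    unfolding S_def by (rule ev) (use Suc.prems in simp)
  have S_prob: "srw.prob (S y) = taboo A v t y / deg y * (\<Prod>i\<in>J. pmf (pmf_of_set (E `` {snd i})) (c i))"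
    if "y \<in> E `` {x}" for y
  proof -
    have "srw.prob (S y) = taboo A v t y * (\<Prod>i\<in>?J y. pmf (pmf_of_set (E `` {snd i})) (?c y i))"
      unfolding S_def by (rule Suc.IH) (use Suc.prems in \<open>auto dest: Suc_leD\<close>)
    also have "(\<Prod>i\<in>?J y. pmf (pmf_of_set (E `` {snd i})) (?c y i)) =
        pmf (pmf_of_set (E `` {y})) x * (\<Prod>i\<in>J. pmf (pmf_of_set (E `` {snd i})) (?c y i))"
      using Suc.prems nJ by simp
    also have "(\<Prod>i\<in>J. pmf (pmf_of_set (E `` {snd i})) (?c y i))
        = (\<Prod>i\<in>J. pmf (pmf_of_set (E `` {snd i})) (c i))"
      by (rule prod.cong) (use nJ in auto)
    also have "pmf (pmf_of_set (E `` {y})) x = 1 / deg y"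
      using that edge_sym by (simp add: pmf_of_set)
    finally show ?thesis by simp
  qed
  have "srw.prob {\<omega>. srw v \<omega> (Suc t) = x \<and> (\<forall>s. 0 < s \<and> s < Suc t \<longrightarrow> srw v \<omega> s \<in> A) \<and> (\<forall>i\<in>J. \<omega> i = c i)}
      = srw.prob (\<Union>y\<in>?B. S y)"
  proof (rule srw.finite_measure_eq_AE)
    \<comment> \<open>Only almost surely: on a null set an instruction may not follow an edge, and
      then the predecessor of \<open>x\<close> need not be a neighbour.\<close>
    have "\<omega> \<in> {\<omega>. srw v \<omega> (Suc t) = x \<and> (\<forall>s. 0 < s \<and> s < Suc t \<longrightarrow> srw v \<omega> s \<in> A) \<and> (\<forall>i\<in>J. \<omega> i = c i)}
        \<longleftrightarrow> \<omega> \<in> (\<Union>y\<in>?B. S y)" if "\<forall>y. \<omega> (t, y) \<in> E `` {y}" for \<omega>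
    proof -
      have "(srw v \<omega> t, \<omega> (t, srw v \<omega> t)) \<in> E" using that by auto
      moreover have "(\<forall>i\<in>?J y. \<omega> i = ?c y i) \<longleftrightarrow> \<omega> (t, y) = x \<and> (\<forall>i\<in>J. \<omega> i = c i)" for y
        using nJ by auto
      moreover have "(\<forall>s. 0 < s \<and> s < Suc t \<longrightarrow> srw v \<omega> s \<in> A) \<longleftrightarrow>
          (t = 0 \<or> srw v \<omega> t \<in> A) \<and> (\<forall>s. 0 < s \<and> s < t \<longrightarrow> srw v \<omega> s \<in> A)"
        by (auto simp: less_Suc_eq)
      ultimately show ?thesis
        unfolding S_def using edge_sym[of "srw v \<omega> t" x] by auto
    qed
    then show "AE \<omega> in W. (\<omega> \<in> {\<omega>. srw v \<omega> (Suc t) = x \<and> (\<forall>s. 0 < s \<and> s < Suc t \<longrightarrow> srw v \<omega> s \<in> A) \<and> (\<forall>i\<in>J. \<omega> i = c i)})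
        = (\<omega> \<in> (\<Union>y\<in>?B. S y))"
      by (intro AE_mp[OF AE_instructions[of t] AE_I2[OF impI]]) blast
  next
    show "{\<omega>. srw v \<omega> (Suc t) = x \<and> (\<forall>s. 0 < s \<and> s < Suc t \<longrightarrow> srw v \<omega> s \<in> A) \<and> (\<forall>i\<in>J. \<omega> i = c i)} \<in> srw.events"
      by (rule ev) fact
    show "(\<Union>y\<in>?B. S y) \<in> srw.events"
      by (rule sets.finite_UN[OF finB S_ev])
  qed
  also have "\<dots> = (\<Sum>y\<in>?B. srw.prob (S y))"
  proof (rule srw.finite_measure_finite_Union[OF finB])
    show "S ` ?B \<subseteq> srw.events" using S_ev by blast
    show "disjoint_family_on S ?B" by (auto simp: disjoint_family_on_def S_def)
  qed
  also have "\<dots> = (\<Sum>y\<in>?B. taboo A v t y / deg y * (\<Prod>i\<in>J. pmf (pmf_of_set (E `` {snd i})) (c i)))"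
    by (rule sum.cong) (use S_prob in auto)
  also have "\<dots> = (\<Sum>y\<in>?B. taboo A v t y / deg y) * (\<Prod>i\<in>J. pmf (pmf_of_set (E `` {snd i})) (c i))"
    by (rule sum_distrib_right[symmetric])
  also have "(\<Sum>y\<in>?B. taboo A v t y / deg y) = taboo A v (Suc t) x"
    unfolding taboo.simps by (rule sum.inter_filter) simp
  finally show ?case .
qed

lemma prob_taboo:
  "srw.prob {\<omega>. srw v \<omega> t = x \<and> (\<forall>s. 0 < s \<and> s < t \<longrightarrow> srw v \<omega> s \<in> A)} = taboo A v t x"
  using prob_taboo_instructions[of "{}" t v x A undefined] by simp

section \<open>Transition probabilities and first returns\<close>

primrec walk_prob :: "nat \<Rightarrow> 'v \<Rightarrow> 'v \<Rightarrow> real" where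
  "walk_prob 0 v x = of_bool (v = x)"
| "walk_prob (Suc t) v x = (\<Sum>y\<in>E `` {v}. walk_prob t y x) / deg v"

lemma walk_prob_nonneg: "0 \<le> walk_prob t v x"
  by (induction t arbitrary: v) (auto intro!: sum_nonneg divide_nonneg_nonneg)

text \<open>\<open>walk_prob\<close> splits off the first step, as the Green equation requires, and
  \<open>taboo\<close> the last; exchanging two finite sums reconciles them.\<close>

lemma walk_prob_last_step: "walk_prob (Suc t) v x = (\<Sum>y\<in>E `` {x}. walk_prob t v y / deg y)"
proof (induction t arbitrary: v)
  case 0
  have "(\<Sum>y\<in>E `` {v}. of_bool (y = x)) = (of_bool (x \<in> E `` {v}) :: real)"
    by (simp add: of_bool_def sum.delta)
  moreover have "(\<Sum>y\<in>E `` {x}. of_bool (v = y) / real (deg y)) = of_bool (v \<in> E `` {x}) / real (deg v)"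
    by (simp add: of_bool_def if_distrib[of "\<lambda>u. u / _"] sum.delta' cong: if_cong)
  ultimately show ?case
    using edge_sym[of v x] by simp
next
  case (Suc t)
  have "walk_prob (Suc (Suc t)) v x = (\<Sum>y\<in>E `` {v}. \<Sum>z\<in>E `` {x}. walk_prob t y z / deg z) / deg v"
    unfolding walk_prob.simps(2)[of "Suc t"] Suc ..
  also have "\<dots> = (\<Sum>z\<in>E `` {x}. \<Sum>y\<in>E `` {v}. walk_prob t y z / deg z) / deg v"
    by (subst sum.swap) simp
  also have "\<dots> = (\<Sum>z\<in>E `` {x}. (\<Sum>y\<in>E `` {v}. walk_prob t y z) / deg v / deg z)"
    by (simp add: sum_divide_distrib mult.commute)
  finally show ?case by simp
qed

lemma taboo_UNIV: "taboo UNIV v t x = walk_prob t v x"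
  by (induction t arbitrary: x) (simp_all add: walk_prob_last_step del: walk_prob.simps(2))

lemma prob_srw: "srw.prob {\<omega>. srw v \<omega> t = x} = walk_prob t v x"
  using prob_taboo[of v t x UNIV] by (simp add: taboo_UNIV)

text \<open>Decomposition by the time \<open>s\<close> of the first return to \<open>v\<close>. The
  first term is the case without a return; it is absent for \<open>x = v\<close> and
  \<open>t > 0\<close>, where the present visit is itself a return.\<close>

lemma renewal:
  "walk_prob t v x = (if t = 0 \<or> x \<noteq> v then taboo (- {v}) v t x else 0)
     + (\<Sum>s=1..t. taboo (- {v}) v s v * walk_prob (t - s) v x)"
proof (induction t arbitrary: x)
  case (Suc t)
  let ?f = "\<lambda>s. taboo (- {v}) v s v"
  have "walk_prob (Suc t) v x = (\<Sum>y\<in>E `` {x}. walk_prob t v y / deg y)"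
    by (rule walk_prob_last_step)
  also have "\<dots> = (\<Sum>y\<in>E `` {x}. (if t = 0 \<or> y \<in> - {v} then taboo (- {v}) v t y / deg y else 0)
      + (\<Sum>s=1..t. ?f s * (walk_prob (t - s) v y / deg y)))"
    by (subst Suc, rule sum.cong) (auto simp: add_divide_distrib sum_divide_distrib)
  also have "\<dots> = taboo (- {v}) v (Suc t) x + (\<Sum>s=1..t. ?f s * (\<Sum>y\<in>E `` {x}. walk_prob (t - s) v y / deg y))"
    unfolding sum.distrib sum_distrib_left by (subst (2) sum.swap) simp
  also have "(\<Sum>s=1..t. ?f s * (\<Sum>y\<in>E `` {x}. walk_prob (t - s) v y / deg y))
      = (\<Sum>s=1..t. ?f s * walk_prob (Suc t - s) v x)"
    by (rule sum.cong) (auto simp: Suc_diff_le walk_prob_last_step simp del: walk_prob.simps(2))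
  \<comment> \<open>As \<open>walk_prob 0\<close> is an indicator, the term
    \<open>taboo (- {v}) v (Suc t) x\<close> is the summand \<open>s = Suc t\<close> if
    \<open>x = v\<close>, and the no-return term otherwise.\<close>
  finally show ?case by (auto simp del: walk_prob.simps(2) taboo.simps(2))
qed simp

lemma return_prob_sum_le:
  "(\<Sum>s=1..n. taboo (- {v}) v s v) \<le> srw.prob {\<omega> \<in> space W. \<exists>t>0. srw v \<omega> t = v}"
proof -
  let ?A = "\<lambda>s. {\<omega>. srw v \<omega> s = v \<and> (\<forall>r. 0 < r \<and> r < s \<longrightarrow> srw v \<omega> r \<in> - {v})}"
  have A: "?A s \<in> srw.events" for s
    using sets.Int[OF srw_event[of "\<lambda>z. z = v" v s] srw_between_event[of s v "- {v}"]]
    by (simp add: Int_def)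
  have "(\<Sum>s=1..n. taboo (- {v}) v s v) = (\<Sum>s=1..n. srw.prob (?A s))"
    by (simp only: prob_taboo)
  also have "\<dots> = srw.prob (\<Union>s\<in>{1..n}. ?A s)"
  proof (rule srw.finite_measure_finite_Union[symmetric])
    show "disjoint_family_on ?A {1..n}"
      unfolding disjoint_family_on_def
    proof (intro ballI impI)
      fix r s assume "r \<in> {1..n}" "s \<in> {1..n}" "r \<noteq> s"
      then have "0 < r" "0 < s" "r < s \<or> s < r" by auto
      then show "?A r \<inter> ?A s = {}" by blast
    qed
  qed (use A in auto)
  also have "\<dots> \<le> srw.prob {\<omega> \<in> space W. \<exists>t>0. srw v \<omega> t = v}"
  proof (rule srw.finite_measure_mono)
    show "(\<Union>s\<in>{1..n}. ?A s) \<subseteq> {\<omega> \<in> space W. \<exists>t>0. srw v \<omega> t = v}"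
    proof
      fix \<omega> assume "\<omega> \<in> (\<Union>s\<in>{1..n}. ?A s)"
      then obtain s where "s \<in> {1..n}" "srw v \<omega> s = v" by blast
      then show "\<omega> \<in> {\<omega> \<in> space W. \<exists>t>0. srw v \<omega> t = v}"
        by (auto intro!: exI[of _ s])
    qed
    have "{\<omega> \<in> space W. \<exists>t. 0 < t \<and> srw v \<omega> t = v} \<in> srw.events"
      by (rule sets.sets_Collect_countable_Ex)
         (use srw_event[of "\<lambda>z. 0 < t \<and> z = v" v t for t] in simp)
    then show "{\<omega> \<in> space W. \<exists>t>0. srw v \<omega> t = v} \<in> srw.events" .
  qed
  finally show ?thesis .
qed

end

section \<open>Transience and the Green function\<close>

locale transient_graph = lgraph E for E :: "('v \<times> 'v) set" +
  assumes trans: "transient E"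
begin

text \<open>With return probability \<open>\<phi> < 1\<close>, the renewal equation gives
  \<open>G \<le> 1 + \<phi> * G\<close> for every partial sum \<open>G\<close>.\<close>

lemma summable_walk_prob_return: "summable (\<lambda>t. walk_prob t v v)"
proof -
  define \<phi> where "\<phi> = srw.prob {\<omega> \<in> space W. \<exists>t>0. srw v \<omega> t = v}"
  let ?f = "\<lambda>s. taboo (- {v}) v s v"
  have "\<phi> < 1" using trans by (simp add: transient_def \<phi>_def)
  have bound: "(\<Sum>t\<le>n. walk_prob t v v) \<le> 1 / (1 - \<phi>)" for n
  proof -
    let ?G = "\<Sum>t\<le>n. walk_prob t v v"
    have G: "0 \<le> ?G" by (intro sum_nonneg walk_prob_nonneg)
    have "?G = (\<Sum>t\<le>n. of_bool (t = 0) + (\<Sum>s=1..t. ?f s * walk_prob (t - s) v v))"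
      by (rule sum.cong[OF refl], subst renewal) auto
    also have "\<dots> = 1 + (\<Sum>t\<le>n. \<Sum>s=1..t. ?f s * walk_prob (t - s) v v)"
      by (simp add: sum.distrib)
    also have "(\<Sum>t\<le>n. \<Sum>s=1..t. ?f s * walk_prob (t - s) v v)
        = (\<Sum>t\<le>n. \<Sum>s | s \<in> {1..n} \<and> s \<le> t. ?f s * walk_prob (t - s) v v)"
      by (intro sum.cong) auto
    also have "\<dots> = (\<Sum>s=1..n. \<Sum>t | t \<in> {..n} \<and> s \<le> t. ?f s * walk_prob (t - s) v v)"
      by (rule sum.swap_restrict) auto
    also have "\<dots> \<le> (\<Sum>s=1..n. ?f s * ?G)"
    proof (rule sum_mono)
      fix s assume "s \<in> {1..n}"
      have "(\<Sum>t | t \<in> {..n} \<and> s \<le> t. walk_prob (t - s) v v) = (\<Sum>t\<in>{..n - s}. walk_prob t v v)"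
        by (rule sum.reindex_bij_witness[of _ "\<lambda>t. t + s" "\<lambda>t. t - s"]) (use \<open>s \<in> {1..n}\<close> in auto)
      also have "\<dots> \<le> ?G" by (rule sum_mono2) (auto simp: walk_prob_nonneg)
      finally show "(\<Sum>t | t \<in> {..n} \<and> s \<le> t. ?f s * walk_prob (t - s) v v) \<le> ?f s * ?G"
        by (simp add: sum_distrib_left[symmetric] mult_left_mono taboo_nonneg)
    qed
    also have "\<dots> \<le> \<phi> * ?G"
      unfolding sum_distrib_right[symmetric] \<phi>_def
      by (rule mult_right_mono[OF return_prob_sum_le G])
    finally show ?thesis using \<open>\<phi> < 1\<close> by (simp add: field_simps)
  qed
  show ?thesis
  proof (rule summableI_nonneg_bounded)
    fix n
    have "(\<Sum>t<n. walk_prob t v v) \<le> (\<Sum>t\<le>n. walk_prob t v v)"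
      by (rule sum_mono2) (auto simp: walk_prob_nonneg)
    then show "(\<Sum>t<n. walk_prob t v v) \<le> 1 / (1 - \<phi>)"
      using bound by (rule order_trans)
  qed (rule walk_prob_nonneg)
qed

lemma walk_prob_mult_le: "walk_prob s u v * walk_prob t v x \<le> walk_prob (s + t) u x"
proof (induction s arbitrary: u)
  case (Suc s)
  have "walk_prob (Suc s) u v * walk_prob t v x = (\<Sum>y\<in>E `` {u}. walk_prob s y v * walk_prob t v x) / deg u"
    by (simp add: sum_distrib_right)
  also have "\<dots> \<le> (\<Sum>y\<in>E `` {u}. walk_prob (s + t) y x) / deg u"
    by (intro divide_right_mono sum_mono Suc) simp
  finally show ?case by simp
qed (simp add: walk_prob_nonneg)

lemma ex_walk_prob_pos: "\<exists>t. 0 < walk_prob t u v"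
  using conn[of u v]
proof (induction rule: converse_rtrancl_induct)
  case base
  have "0 < walk_prob 0 v v" by simp
  then show ?case ..
next
  case (step u w)
  then obtain t where "0 < walk_prob t w v" by blast
  moreover have "walk_prob t w v \<le> (\<Sum>y\<in>E `` {u}. walk_prob t y v)"
    by (rule member_le_sum) (use step walk_prob_nonneg in auto)
  ultimately have "0 < walk_prob (Suc t) u v" by simp
  then show ?case ..
qed

text \<open>The walk goes from \<open>x\<close> to \<open>w\<close> in some \<open>s\<close> steps
  with positive probability, so \<open>walk_prob t w x\<close> is at most a constant times the
  return probability of \<open>x\<close> at time \<open>s + t\<close>.\<close>

lemma summable_walk_prob: "summable (\<lambda>t. walk_prob t w x)"
proof -
  obtain s where s: "0 < walk_prob s x w" using ex_walk_prob_pos by blast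
  have "summable (\<lambda>t. walk_prob (s + t) x x)"
    using summable_walk_prob_return summable_iff_shift[of "\<lambda>t. walk_prob t x x" s] by (simp add: add.commute)
  then have "summable (\<lambda>t. walk_prob (s + t) x x / walk_prob s x w)"
    by (rule summable_divide)
  then show ?thesis
    by (rule summable_comparison_test[rotated])
       (use s walk_prob_mult_le[of s x w _ x] in \<open>auto simp: walk_prob_nonneg field_simps\<close>)
qed

definition Green :: "'v \<Rightarrow> 'v \<Rightarrow> real" where
  "Green w x = (\<Sum>t. walk_prob t w x)"

lemma green_eq_Green: "green E a x = ennreal (Green a x)"
proof -
  have "green E a x = (\<integral>\<^sup>+ \<omega>. (\<Sum>t. indicator {\<omega>. srw a \<omega> t = x} \<omega>) \<partial>W)"
    unfolding green_def
  proof (rule nn_integral_cong)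
    fix \<omega>
    have "visits (srw a \<omega>) x = (\<integral>\<^sup>+ t. indicator {t. srw a \<omega> t = x} t \<partial>count_space UNIV)"
      by (simp add: visits_def)
    also have "\<dots> = (\<Sum>t. indicator {\<omega>. srw a \<omega> t = x} \<omega>)"
      by (simp add: nn_integral_count_space_nat indicator_def)
    finally show "visits (srw a \<omega>) x = (\<Sum>t. indicator {\<omega>. srw a \<omega> t = x} \<omega>)" .
  qed
  also have "\<dots> = (\<Sum>t. emeasure W {\<omega>. srw a \<omega> t = x})"
    by (subst nn_integral_suminf)
       (simp_all add: srw_event[of "\<lambda>z. z = x"] nn_integral_indicator[unfolded indicator_def] indicator_def)
  also have "\<dots> = (\<Sum>t. ennreal (walk_prob t a x))"
    by (simp add: srw.emeasure_eq_measure prob_srw)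
  also have "\<dots> = ennreal (Green a x)"
    unfolding Green_def by (rule suminf_ennreal2[OF walk_prob_nonneg summable_walk_prob])
  finally show ?thesis .
qed

lemma Green_nonneg: "0 \<le> Green w x"
  unfolding Green_def by (intro suminf_nonneg summable_walk_prob walk_prob_nonneg)

lemma Green_step: "Green w x = of_bool (w = x) + (\<Sum>y\<in>E `` {w}. Green y x) / deg w"
proof -
  have "Green w x = (\<Sum>t. walk_prob (Suc t) w x) + walk_prob 0 w x"
    unfolding Green_def using suminf_split_head[OF summable_walk_prob] by (simp del: walk_prob.simps(2))
  also have "(\<Sum>t. walk_prob (Suc t) w x) = (\<Sum>t. \<Sum>y\<in>E `` {w}. walk_prob t y x) / deg w"
    by (simp add: suminf_divide summable_sum summable_walk_prob)
  also have "(\<Sum>t. \<Sum>y\<in>E `` {w}. walk_prob t y x) = (\<Sum>y\<in>E `` {w}. Green y x)"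
    unfolding Green_def by (rule suminf_sum) (rule summable_walk_prob)
  finally show ?thesis by simp
qed

lemma Green_partial_sum:
  "(\<Sum>t<Suc n. walk_prob t w x) = of_bool (w = x) + (\<Sum>y\<in>E `` {w}. \<Sum>t<n. walk_prob t y x) / deg w"
  unfolding sum.lessThan_Suc_shift
  by (simp add: sum_divide_distrib[symmetric]) (subst sum.swap, simp)

text \<open>The tail of the series for \<open>Green w x\<close> from time \<open>n\<close> on is the
  mean of \<open>Green\<close> over the position at time \<open>n\<close>. A positive lower bound
  for \<open>Green\<close> would bound all tails from below, but they tend to 0.\<close>

lemma ex_Green_less:
  assumes "0 < \<epsilon>"
  shows "\<exists>w. Green w x < \<epsilon>"
proof (rule ccontr)
  assume "\<not> ?thesis"
  then have ge: "\<epsilon> \<le> Green w x" for w by (simp add: not_less)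
  have tail: "\<epsilon> \<le> Green w x - (\<Sum>t<n. walk_prob t w x)" for n w
  proof (induction n arbitrary: w)
    case (Suc n)
    have "\<epsilon> = (\<Sum>y\<in>E `` {w}. \<epsilon>) / deg w" by simp
    also have "\<dots> \<le> (\<Sum>y\<in>E `` {w}. Green y x - (\<Sum>t<n. walk_prob t y x)) / deg w"
      by (intro divide_right_mono sum_mono Suc) simp
    also have "\<dots> = Green w x - (\<Sum>t<Suc n. walk_prob t w x)"
      by (subst Green_step[of w], subst Green_partial_sum) (simp add: sum_subtractf diff_divide_distrib)
    finally show ?case .
  qed (simp add: ge)
  have "(\<lambda>n. Green x x - (\<Sum>t<n. walk_prob t x x)) \<longlonglongrightarrow> Green x x - Green x x"
    unfolding Green_def by (intro tendsto_diff tendsto_const summable_LIMSEQ summable_walk_prob)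
  then have "\<epsilon> \<le> Green x x - Green x x"
    by (rule LIMSEQ_le_const) (use tail in blast)
  then show False using assms by simp
qed

lemma sum_walk_prob_vertices:
  assumes "finite (UNIV :: 'v set)"
  shows "(\<Sum>x\<in>UNIV. walk_prob t v x) = 1"
proof (induction t arbitrary: v)
  case (Suc t)
  have "(\<Sum>x\<in>UNIV. walk_prob (Suc t) v x) = (\<Sum>y\<in>E `` {v}. \<Sum>x\<in>UNIV. walk_prob t y x) / deg v"
    by (simp add: sum_divide_distrib[symmetric]) (subst sum.swap, simp)
  then show ?case using Suc by simp
qed (use assms in \<open>simp add: of_bool_def\<close>)

lemma infinite_vertices: "infinite (UNIV :: 'v set)"
proof
  assume fin: "finite (UNIV :: 'v set)"
  fix v :: 'v
  have "summable (\<lambda>t. \<Sum>x\<in>UNIV. walk_prob t v x)"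
    by (intro summable_sum summable_walk_prob)
  then have "(\<lambda>t. 1 :: real) \<longlonglongrightarrow> 0"
    using summable_LIMSEQ_zero sum_walk_prob_vertices[OF fin] by simp
  then show False by (simp add: LIMSEQ_const_iff)
qed

end

section \<open>The killed Green function as a forest count\<close>

context transient_graph begin

text \<open>By the matrix-tree theorem this is the Green function of the walk killed on
  \<open>Z\<close>. That walk is never constructed; the formula is identified by its linear equation
  and its boundary values.\<close>

definition killed_green :: "'v set \<Rightarrow> 'v \<Rightarrow> 'v \<Rightarrow> real" where
  "killed_green Z w x = deg x * linked Z x w / card (forests Z)"

lemma killed_green_nonneg: "0 \<le> killed_green Z w x"
  by (simp add: killed_green_def linked_nonneg)

lemma killed_green_outside: "w \<in> Z \<Longrightarrow> x \<notin> Z \<Longrightarrow> killed_green Z w x = 0"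
  by (simp add: killed_green_def linked_eq_0)

lemma card_forests_pos: "finite (- Z) \<Longrightarrow> Z \<noteq> {} \<Longrightarrow> 0 < card (forests Z)"
  using finite_forests forests_nonempty by (metis card_gt_0_iff)

lemma killed_green_step:
  assumes "finite (- Z)" "Z \<noteq> {}" "x \<notin> Z" "w \<notin> Z"
  shows "killed_green Z w x = of_bool (w = x) + (\<Sum>y\<in>E `` {w}. killed_green Z y x) / deg w"
proof (cases "w = x")
  case True
  have c: "0 < real (card (forests Z))"
    using card_forests_pos assms by simp
  have "real (card (forests Z)) = deg x * linked Z x x - (\<Sum>y\<in>E `` {x}. linked Z x y)"
    unfolding card_forests_linked[OF assms(1,3)] by (simp add: sum_subtractf)
  then have "(\<Sum>y\<in>E `` {x}. linked Z x y) = deg x * linked Z x x - card (forests Z)"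
    by simp
  moreover have "(\<Sum>y\<in>E `` {x}. killed_green Z y x) = deg x * (\<Sum>y\<in>E `` {x}. linked Z x y) / card (forests Z)"
    by (simp add: killed_green_def sum_divide_distrib sum_distrib_left)
  ultimately have "(\<Sum>y\<in>E `` {x}. killed_green Z y x) / deg x = (deg x * linked Z x x - card (forests Z)) / card (forests Z)"
    by simp
  also have "\<dots> = killed_green Z x x - 1"
    using c by (simp add: killed_green_def diff_divide_distrib)
  finally show ?thesis using True by simp
next
  case False
  have "(\<Sum>y\<in>E `` {w}. killed_green Z y x) = deg x * (\<Sum>y\<in>E `` {w}. linked Z x y) / card (forests Z)"
    by (simp add: killed_green_def sum_divide_distrib sum_distrib_left)
  also have "\<dots> / deg w = killed_green Z w x"
    unfolding linked_harmonic[OF assms(1,4) False, symmetric] by (simp add: killed_green_def)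
  finally show ?thesis using False by simp
qed

text \<open>Minimum principle: the difference \<open>d\<close> is harmonic off \<open>Z\<close> and
  nonnegative on \<open>Z\<close>. A negative minimum would spread to all neighbours of a minimising
  vertex, hence by connectivity into \<open>Z\<close>.\<close>

lemma killed_green_le_Green:
  assumes "finite (- Z)" "Z \<noteq> {}" "x \<notin> Z"
  shows "killed_green Z w x \<le> Green w x"
proof (rule ccontr)
  define d where "d w = Green w x - killed_green Z w x" for w
  assume "\<not> ?thesis"
  then have "d w < 0" by (simp add: d_def)
  have d_Z: "0 \<le> d w" if "w \<in> Z" for w
    using that assms by (simp add: d_def killed_green_outside Green_nonneg)
  with \<open>d w < 0\<close> have "w \<notin> Z" by fastforce
  then obtain m where m: "m \<notin> Z" "\<And>w. w \<notin> Z \<Longrightarrow> d m \<le> d w"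
    using ex_is_arg_min_if_finite[of "- Z" d] assms(1) by (auto simp: is_arg_min_linorder)
  have neg: "d m < 0" using m(2)[OF \<open>w \<notin> Z\<close>] \<open>d w < 0\<close> by simp
  then have min: "d m \<le> d w" for w using m(2)[of w] d_Z[of w] by (cases "w \<in> Z") auto
  have mean: "d w = (\<Sum>y\<in>E `` {w}. d y) / deg w" if "w \<notin> Z" for w
    using killed_green_step[OF assms that] Green_step[of w x]
    by (simp add: d_def sum_subtractf diff_divide_distrib)
  have "u \<notin> Z \<and> d u = d m" for u
    using conn[of m u]
  proof (induction rule: rtrancl_induct)
    case (step u v)
    then have u: "u \<notin> Z" "d u = d m" by auto
    have "(\<Sum>y\<in>E `` {u}. d y - d m) = 0"
      using mean[OF u(1)] u(2) by (simp add: sum_subtractf field_simps)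
    then have "d v - d m = 0"
      using sum_nonneg_0[of "E `` {u}" "\<lambda>y. d y - d m" v] min step by simp
    then show ?case using d_Z[of v] neg by auto
  qed (use m in simp)
  then show False using assms(2) by blast
qed

section \<open>Convergence along an exhaustion\<close>

lemma exhausting_eventually:
  assumes "exhausting Z"
  shows "eventually (\<lambda>R. w \<notin> Z R) sequentially"
proof -
  have "(\<Inter>R. Z R) = {}" "decseq Z"
    using assms by (auto simp: exhausting_def)
  then obtain R where "w \<notin> Z R" by blast
  then have "w \<notin> Z R'" if "R \<le> R'" for R'
    using that decseqD[OF \<open>decseq Z\<close>] by blast
  then show ?thesis by (auto simp: eventually_sequentially)
qed

lemma exhausting_finite: "exhausting Z \<Longrightarrow> finite (- Z R)"
  by (simp add: exhausting_def)

lemma cofinite_nonempty: "finite (- Z) \<Longrightarrow> Z \<noteq> ({} :: 'v set)"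
  using infinite_vertices by auto

text \<open>Off \<open>Z R\<close> both sides obey the same one-step recursion. Only vertices within
  \<open>n\<close> steps of \<open>w\<close>, and \<open>x\<close>, matter, and these are eventually
  off \<open>Z R\<close>.\<close>

lemma killed_green_ge_partial_sum:
  assumes "exhausting Z"
  shows "eventually (\<lambda>R. (\<Sum>t<n. walk_prob t w x) \<le> killed_green (Z R) w x) sequentially"
proof (induction n arbitrary: w)
  case (Suc n)
  have "eventually (\<lambda>R. \<forall>y\<in>E `` {w}. (\<Sum>t<n. walk_prob t y x) \<le> killed_green (Z R) y x) sequentially"
    by (rule eventually_ball_finite) (use Suc in auto)
  then show ?case
    using exhausting_eventually[OF assms, of w] exhausting_eventually[OF assms, of x]
  proof eventually_elim
    case (elim R)
    note fin = exhausting_finite[OF assms, of R]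
    have "(\<Sum>t<Suc n. walk_prob t w x) = of_bool (w = x) + (\<Sum>y\<in>E `` {w}. \<Sum>t<n. walk_prob t y x) / deg w"
      by (rule Green_partial_sum)
    also have "\<dots> \<le> of_bool (w = x) + (\<Sum>y\<in>E `` {w}. killed_green (Z R) y x) / deg w"
      using elim by (intro add_left_mono divide_right_mono sum_mono) auto
    also have "\<dots> = killed_green (Z R) w x"
      using killed_green_step[OF fin cofinite_nonempty[OF fin] elim(3,2)] by simp
    finally show ?case .
  qed
qed (simp add: killed_green_nonneg)

lemma killed_green_tendsto:
  assumes "exhausting Z"
  shows "(\<lambda>R. killed_green (Z R) w x) \<longlonglongrightarrow> Green w x"
proof (rule order_tendstoI)
  fix c assume "c < Green w x"
  then have "eventually (\<lambda>n. c < (\<Sum>t<n. walk_prob t w x)) sequentially"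
    using summable_LIMSEQ[OF summable_walk_prob[of w x]] unfolding Green_def
    by (rule order_tendstoD(1)[rotated])
  then obtain n where "c < (\<Sum>t<n. walk_prob t w x)"
    using eventually_happens'[OF sequentially_bot] by blast
  then show "eventually (\<lambda>R. c < killed_green (Z R) w x) sequentially"
    using killed_green_ge_partial_sum[OF assms, where n = n and w = w and x = x] by (auto elim: eventually_mono)
next
  fix c assume c: "Green w x < c"
  show "eventually (\<lambda>R. killed_green (Z R) w x < c) sequentially"
    using exhausting_eventually[OF assms, of x]
  proof eventually_elim
    case (elim R)
    note fin = exhausting_finite[OF assms, of R]
    show ?case
      using killed_green_le_Green[OF fin cofinite_nonempty[OF fin] elim, of w] c by simp
  qed
qed

lemma ex_exhausting: "\<exists>Z :: nat \<Rightarrow> 'v set. exhausting Z"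
proof -
  let ?Z = "\<lambda>R. UNIV - from_nat_into (UNIV :: 'v set) ` {..<R}"
  have "range (from_nat_into (UNIV :: 'v set)) = UNIV"
    using range_from_nat_into[OF _ countable_vertices] by simp
  have "(\<Inter>R. ?Z R) = {}"
  proof (rule equals0I)
    fix v assume v: "v \<in> (\<Inter>R. ?Z R)"
    obtain n where "v = from_nat_into UNIV n"
      using \<open>range (from_nat_into UNIV) = UNIV\<close> by (metis rangeE UNIV_I)
    then have "v \<notin> ?Z (Suc n)" by simp
    with v show False by blast
  qed
  moreover have "decseq ?Z"
    by (auto simp: decseq_def)
  ultimately have "exhausting ?Z"
    by (simp add: exhausting_def Compl_eq_Diff_UNIV Diff_Diff_Int)
  then show ?thesis by (rule exI[of exhausting ?Z])
qed

end

section \<open>The killed rotor walk\<close>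

definition rotor_edges :: "('v \<Rightarrow> 'v) \<Rightarrow> 'v set \<Rightarrow> ('v \<times> 'v) set" where
  "rotor_edges \<rho> Y = {(y, \<rho> y) | y. y \<notin> Y}"

lemma rotor_edges_iff [simp]: "(x, y) \<in> rotor_edges \<rho> Y \<longleftrightarrow> x \<notin> Y \<and> y = \<rho> x"
  by (auto simp: rotor_edges_def)

lemma rotor_edges_insert: "rotor_edges \<rho> (insert y Y) = rotor_edges \<rho> Y - {y} \<times> UNIV"
  by auto

lemma rotor_edges_Image: "y \<in> Y \<Longrightarrow> rotor_edges \<rho> Y `` {y} = {}"
  by auto

lemma single_valued_rotor_edges: "single_valued (rotor_edges \<rho> Y)"
  by (auto simp: single_valued_def)

lemma rotor_of_rotor_edges:
  assumes "\<forall>y\<in>Y. \<rho> y = rotor_of {} y"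
  shows "rotor_of (rotor_edges \<rho> Y) = \<rho>"
proof
  fix y show "rotor_of (rotor_edges \<rho> Y) y = \<rho> y"
    using assms by (cases "y \<in> Y") (auto simp: rotor_of_def)
qed

locale rotor_system = lgraph E for E :: "('v \<times> 'v) set" +
  fixes \<tau> :: "'v \<Rightarrow> 'v \<Rightarrow> 'v" and a :: 'v
  assumes mechanism: "\<And>x. local_mechanism E x (\<tau> x)"
begin

lemma rotor_edges_rotor_of:
  assumes "oriented_forest E Y F"
  shows "rotor_edges (rotor_of F) Y = F"
proof -
  have the: "rotor_of F x = y" if "(x, y) \<in> F" for x y
    using that forest_single_valued[OF assms] by (auto simp: rotor_of_def single_valued_def)
  show ?thesis
  proof (intro set_eqI iffI; clarify)
    fix x y assume "(x, y) \<in> rotor_edges (rotor_of F) Y"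
    then have "x \<notin> Y" "y = rotor_of F x" by auto
    moreover from \<open>x \<notin> Y\<close> obtain y' where "(x, y') \<in> F"
      using assms unfolding oriented_forest_def by blast
    ultimately show "(x, y) \<in> F" using the by blast
  next
    fix x y assume "(x, y) \<in> F"
    moreover from this have "x \<notin> Y" using assms by (auto simp: oriented_forest_def)
    ultimately show "(x, y) \<in> rotor_edges (rotor_of F) Y" using the by simp
  qed
qed

lemma rotor_of_sink:
  assumes "oriented_forest E Y F" "y \<in> Y"
  shows "rotor_of F y = rotor_of {} y"
  using assms by (auto simp: oriented_forest_def rotor_of_def Image_def)

section \<open>States of the killed walk and the rotor step\<close>

lemma rotor_next: "(x, v) \<in> E \<Longrightarrow> (x, \<tau> x v) \<in> E"
  using mechanism[of x] by (auto simp: local_mechanism_def bij_betw_def)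

lemma rotor_next_inj: "(x, u) \<in> E \<Longrightarrow> (x, v) \<in> E \<Longrightarrow> \<tau> x u = \<tau> x v \<Longrightarrow> u = v"
  using mechanism[of x] by (auto simp: local_mechanism_def bij_betw_def dest: inj_onD)

text \<open>
  On \<open>Z\<close> the rotors are fixed to the junk value that \<open>rotor_of\<close> gives to vertices of outdegree 0.
\<close>

definition states :: "'v set \<Rightarrow> ('v \<times> ('v \<Rightarrow> 'v)) set" where
  "states Z = {(x, \<rho>). oriented_forest E (insert x Z) (rotor_edges \<rho> (insert x Z)) \<and>
     (a, x) \<in> (rotor_edges \<rho> (insert x Z))\<^sup>* \<and> (x \<notin> Z \<longrightarrow> (x, \<rho> x) \<in> E) \<and>
     (\<forall>y\<in>Z. \<rho> y = rotor_of {} y)}"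

abbreviation live :: "'v set \<Rightarrow> ('v \<times> ('v \<Rightarrow> 'v)) set" where
  "live Z \<equiv> {s \<in> states Z. fst s \<notin> Z}"

abbreviation dead :: "'v set \<Rightarrow> ('v \<times> ('v \<Rightarrow> 'v)) set" where
  "dead Z \<equiv> {s \<in> states Z. fst s \<in> Z}"

abbreviation starts :: "'v set \<Rightarrow> ('v \<times> ('v \<Rightarrow> 'v)) set" where
  "starts Z \<equiv> (\<lambda>F. (a, rotor_of F)) ` forests Z"

lemma rotor_edges_after_step:
  assumes "x \<notin> Z" "x \<noteq> y"
  shows "rotor_edges (\<rho>(x := y)) (insert y Z) =
    insert (x, y) (rotor_edges \<rho> (insert x Z) - {y} \<times> UNIV)"
  using assms by (auto split: if_splits)

text \<open>A path to \<open>x\<close> either meets \<open>y\<close>, and its initial part survives,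
  or it is prolonged by the new edge from \<open>x\<close> to \<open>y\<close>. So everything in the
  tree of the current location stays there.\<close>

lemma reach_step:
  assumes "x \<notin> Z" "x \<noteq> y" "(q, x) \<in> (rotor_edges \<rho> (insert x Z))\<^sup>*"
  shows "(q, y) \<in> (rotor_edges (\<rho>(x := y)) (insert y Z))\<^sup>*"
proof -
  let ?R = "rotor_edges \<rho> (insert x Z) - {y} \<times> UNIV"
  have sub: "?R\<^sup>* \<subseteq> (insert (x, y) ?R)\<^sup>*" by (rule rtrancl_mono) auto
  have "(q, x) \<in> ?R\<^sup>* \<or> (q, y) \<in> ?R\<^sup>*"
    by (rule rtrancl_avoid) fact
  then show ?thesis
    unfolding rotor_edges_after_step[OF assms(1,2)]
    using sub by (meson insertI1 rtrancl.rtrancl_into_rtrancl subsetD)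
qed

text \<open>The new location \<open>y\<close> loses its out-edge before the edge from
  \<open>x\<close> to \<open>y\<close> is added, so no cycle can arise.\<close>

lemma step_in_states:
  assumes "s \<in> live Z"
  shows "rotor_step \<tau> s \<in> states Z"
proof -
  obtain x \<rho> where s: "s = (x, \<rho>)" by (cases s)
  define y where "y = \<tau> x (\<rho> x)"
  let ?R = "rotor_edges \<rho> (insert x Z)"
  have st: "oriented_forest E (insert x Z) ?R" "(a, x) \<in> ?R\<^sup>*" "(x, \<rho> x) \<in> E"
      "\<forall>y\<in>Z. \<rho> y = rotor_of {} y" "x \<notin> Z"
    using assms by (auto simp: states_def s)
  have xy: "(x, y) \<in> E" unfolding y_def by (rule rotor_next) fact
  then have "x \<noteq> y" by auto
  have "oriented_forest E (insert x (insert y Z)) (?R - {y} \<times> UNIV)"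
  proof (cases "y \<in> Z")
    case True
    then have "?R - {y} \<times> UNIV = ?R" "insert y Z = Z" by auto
    then show ?thesis using st by simp
  next
    case False
    with \<open>x \<noteq> y\<close> have "y \<notin> insert x Z" by auto
    from forest_remove[OF st(1) this] show ?thesis by (simp add: insert_commute)
  qed
  moreover have "(y, x) \<notin> (?R - {y} \<times> UNIV)\<^sup>*"
  proof -
    have "(?R - {y} \<times> UNIV) `` {y} = {}" by auto
    from rtrancl_from_sink[OF this] \<open>x \<noteq> y\<close> show ?thesis by simp
  qed
  ultimately have "oriented_forest E (insert y Z) (rotor_edges (\<rho>(x := y)) (insert y Z))"
    unfolding rotor_edges_after_step[OF st(5) \<open>x \<noteq> y\<close>]
    using st(5) \<open>x \<noteq> y\<close> xy by (intro forest_insert) auto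
  moreover have "(y, (\<rho>(x := y)) y) \<in> E" if "y \<notin> Z"
  proof -
    have "(y, \<rho> y) \<in> ?R" using that \<open>x \<noteq> y\<close> by simp
    then have "(y, \<rho> y) \<in> E" using st(1) by (auto simp: oriented_forest_def)
    then show ?thesis using \<open>x \<noteq> y\<close> by simp
  qed
  moreover have "\<forall>z\<in>Z. (\<rho>(x := y)) z = rotor_of {} z" using st by auto
  ultimately show ?thesis
    using reach_step[OF st(5) \<open>x \<noteq> y\<close> st(2)] by (auto simp: states_def s y_def[symmetric])
qed

text \<open>Both candidate predecessors have rotors pointing to \<open>y\<close>. Since
  \<open>a\<close> leads to both, one lies on the forward path of the other, so the rotors contain a
  cycle through \<open>y\<close>. The out-edge of each candidate would have to lie on that cycle,
  because deleting it leaves no cycle; but only one edge of the cycle enters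
  \<open>y\<close>.\<close>

lemma step_inj:
  assumes s1: "s1 \<in> live Z" and s2: "s2 \<in> live Z" and eq: "rotor_step \<tau> s1 = rotor_step \<tau> s2"
  shows "s1 = s2"
proof -
  obtain x1 \<rho>1 where s1': "s1 = (x1, \<rho>1)" by (cases s1)
  obtain x2 \<rho>2 where s2': "s2 = (x2, \<rho>2)" by (cases s2)
  define y where "y = \<tau> x1 (\<rho>1 x1)"
  define \<sigma> where "\<sigma> = \<rho>1(x1 := y)"
  have y2: "y = \<tau> x2 (\<rho>2 x2)" and \<sigma>2: "\<sigma> = \<rho>2(x2 := y)"
    using eq by (auto simp: s1' s2' y_def \<sigma>_def)
  let ?S = "rotor_edges \<sigma> Z"
  let ?R1 = "rotor_edges \<sigma> (insert x1 Z)" and ?R2 = "rotor_edges \<sigma> (insert x2 Z)"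
  have R1: "rotor_edges \<rho>1 (insert x1 Z) = ?R1" unfolding \<sigma>_def by auto
  have R2: "rotor_edges \<rho>2 (insert x2 Z) = ?R2" unfolding \<sigma>2 by auto
  have st1: "acyclic ?R1" "(a, x1) \<in> ?R1\<^sup>*" "(x1, \<rho>1 x1) \<in> E" "x1 \<notin> Z"
    using s1 by (auto simp: states_def s1' R1 oriented_forest_def)
  have st2: "acyclic ?R2" "(a, x2) \<in> ?R2\<^sup>*" "(x2, \<rho>2 x2) \<in> E" "x2 \<notin> Z"
    using s2 by (auto simp: states_def s2' R2 oriented_forest_def)
  have \<sigma>_x: "\<sigma> x1 = y" "\<sigma> x2 = y" by (simp add: \<sigma>_def) (simp add: \<sigma>2)
  have contra: False
    if u: "u \<notin> Z" "\<sigma> u = y" "acyclic (rotor_edges \<sigma> (insert u Z))"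
      and v: "v \<notin> Z" "\<sigma> v = y" "acyclic (rotor_edges \<sigma> (insert v Z))"
      and "u \<noteq> v" "(y, u) \<in> ?S\<^sup>*" for u v
  proof -
    let ?U = "rotor_edges \<sigma> (insert u Z)" and ?V = "rotor_edges \<sigma> (insert v Z)"
    have yu: "(y, u) \<in> ?U\<^sup>*"
      unfolding rotor_edges_insert by (rule rtrancl_avoid_target) fact
    have "(v, y) \<in> ?U" "(u, y) \<in> ?V" using u v \<open>u \<noteq> v\<close> by auto
    \<comment> \<open>Either the path avoids the out-edge of \<open>v\<close>, and the edge from
      \<open>u\<close> to \<open>y\<close> closes a cycle in \<open>?V\<close>, or it meets
      \<open>v\<close>, and the edge from \<open>v\<close> to \<open>y\<close> closes one in
      \<open>?U\<close>.\<close>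
    have "(y, u) \<in> (?U - {v} \<times> UNIV)\<^sup>* \<or> (y, v) \<in> (?U - {v} \<times> UNIV)\<^sup>*"
      by (rule rtrancl_avoid) fact
    moreover have "?U - {v} \<times> UNIV \<subseteq> ?V" "?U - {v} \<times> UNIV \<subseteq> ?U" by auto
    ultimately have "(y, u) \<in> ?V\<^sup>* \<or> (y, v) \<in> ?U\<^sup>*"
      by (meson rtrancl_mono subsetD)
    then have "(u, u) \<in> ?V\<^sup>+ \<or> (v, v) \<in> ?U\<^sup>+"
      using \<open>(v, y) \<in> ?U\<close> \<open>(u, y) \<in> ?V\<close> by (meson rtrancl_into_trancl2)
    then show False using u(3) v(3) by (auto simp: acyclic_def)
  qed
  have "x1 = x2"
  proof (rule ccontr)
    assume ne: "x1 \<noteq> x2"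
    have sub: "?R1\<^sup>* \<subseteq> ?S\<^sup>*" "?R2\<^sup>* \<subseteq> ?S\<^sup>*"
      by (auto intro!: rtrancl_mono)
    then have "(a, x1) \<in> ?S\<^sup>*" "(a, x2) \<in> ?S\<^sup>*"
      using st1(2) st2(2) by blast+
    then have "(x1, x2) \<in> ?S\<^sup>* \<or> (x2, x1) \<in> ?S\<^sup>*"
      by (rule single_valued_path_linear[OF single_valued_rotor_edges])
    then have "(y, x2) \<in> ?S\<^sup>* \<or> (y, x1) \<in> ?S\<^sup>*"
      using ne \<sigma>_x by (metis converse_rtranclE rotor_edges_iff)
    then show False
      using contra[of x1 x2] contra[of x2 x1] st1 st2 \<sigma>_x ne by blast
  qed
  moreover have "\<rho>1 = \<rho>2"
  proof
    fix z
    show "\<rho>1 z = \<rho>2 z"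
    proof (cases "z = x1")
      case True
      then show ?thesis
        using rotor_next_inj[OF st1(3), of "\<rho>2 x1"] st2(3) y2 \<open>x1 = x2\<close> by (simp add: y_def)
    next
      case False
      then show ?thesis
        using fun_cong[OF trans[OF \<sigma>_def[symmetric] \<sigma>2], of z] \<open>x1 = x2\<close> by simp
    qed
  qed
  ultimately show ?thesis by (simp add: s1' s2')
qed

lemma starts_live:
  assumes "a \<notin> Z" shows "starts Z \<subseteq> live Z"
proof clarify
  fix F assume F: "oriented_forest E Z F"
  have R: "rotor_edges (rotor_of F) Z = F" by (rule rotor_edges_rotor_of[OF F])
  have "(a, rotor_of F a) \<in> rotor_edges (rotor_of F) Z" using assms by simp
  then have "(a, rotor_of F a) \<in> E" using F by (auto simp: R oriented_forest_def)
  then show "(a, rotor_of F) \<in> states Z \<and> fst (a, rotor_of F) \<notin> Z"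
    using forest_remove[OF F assms] rotor_of_sink[OF F] assms
    by (auto simp: states_def rotor_edges_insert R)
qed

text \<open>A step into \<open>a\<close> adds an edge from \<open>x\<close> to \<open>a\<close>
  while \<open>a\<close> leads to \<open>x\<close>, which closes a cycle; the rotors of a start are
  acyclic.\<close>

lemma step_not_start:
  assumes s: "s \<in> live Z"
  shows "rotor_step \<tau> s \<notin> starts Z"
proof
  assume "rotor_step \<tau> s \<in> starts Z"
  then obtain F where F: "oriented_forest E Z F" "rotor_step \<tau> s = (a, rotor_of F)" by auto
  obtain x \<rho> where s': "s = (x, \<rho>)" by (cases s)
  define \<sigma> where "\<sigma> = rotor_of F"
  have \<sigma>: "\<sigma> = \<rho>(x := a)" using F(2) by (metis Pair_inject rotor_step.simps s' \<sigma>_def)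
  have acyc: "acyclic (rotor_edges \<sigma> Z)"
    using F(1) rotor_edges_rotor_of[OF F(1)] by (simp add: \<sigma>_def oriented_forest_def)
  have "rotor_edges \<rho> (insert x Z) \<subseteq> rotor_edges \<sigma> Z" by (auto simp: \<sigma>)
  moreover have "(a, x) \<in> (rotor_edges \<rho> (insert x Z))\<^sup>*" "x \<notin> Z"
    using s by (auto simp: states_def s')
  ultimately have "(a, x) \<in> (rotor_edges \<sigma> Z)\<^sup>*" by (meson rtrancl_mono subsetD)
  moreover have "(x, a) \<in> rotor_edges \<sigma> Z" using \<open>x \<notin> Z\<close> by (simp add: \<sigma>)
  ultimately show False
    using acyc by (meson acyclic_def rtrancl_into_trancl1)
qed

lemma finite_live:
  assumes "finite (- Z)" shows "finite (live Z)"
proof (rule finite_subset)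
  show "live Z \<subseteq> (- Z) \<times> rotor_of ` Pow (E \<inter> (- Z) \<times> UNIV)"
  proof clarify
    fix x \<rho> assume s: "(x, \<rho>) \<in> states Z" "fst (x, \<rho>) \<notin> Z"
    then have "rotor_edges \<rho> Z = insert (x, \<rho> x) (rotor_edges \<rho> (insert x Z))" by auto
    then have "rotor_edges \<rho> Z \<subseteq> E"
      using s by (auto simp: states_def oriented_forest_def)
    moreover have "rotor_edges \<rho> Z \<subseteq> (- Z) \<times> UNIV" by auto
    moreover have "\<rho> = rotor_of (rotor_edges \<rho> Z)"
      using s rotor_of_rotor_edges[of Z \<rho>] by (auto simp: states_def)
    ultimately show "x \<in> - Z \<and> \<rho> \<in> rotor_of ` Pow (E \<inter> (- Z) \<times> UNIV)"
      using s by auto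
  qed
  show "finite ((- Z) \<times> rotor_of ` Pow (E \<inter> (- Z) \<times> UNIV))"
    using finite_edges_from[OF assms] assms by blast
qed

lemma inj_on_rotor_of: "inj_on rotor_of (forests Z)"
  by (rule inj_onI) (metis mem_Collect_eq rotor_edges_rotor_of)

lemma card_starts: "card (starts Z) = card (forests Z)"
  by (rule card_image) (use inj_on_rotor_of in \<open>auto simp: inj_on_def\<close>)

lemma dead_forest:
  assumes "(z, \<sigma>) \<in> dead Z"
  shows "oriented_forest E Z (rotor_edges \<sigma> Z)" "(a, z) \<in> (rotor_edges \<sigma> Z)\<^sup>*" "z \<in> Z"
    "rotor_of (rotor_edges \<sigma> Z) = \<sigma>"
  using assms rotor_of_rotor_edges[of Z \<sigma>] by (auto simp: states_def insert_absorb)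

text \<open>The root to which \<open>a\<close> leads is unique, so the forest determines the dead
  state.\<close>

lemma dead_inj: "inj_on (\<lambda>s. rotor_edges (snd s) Z) (dead Z)"
proof (rule inj_onI)
  fix s t assume st: "s \<in> dead Z" "t \<in> dead Z" "rotor_edges (snd s) Z = rotor_edges (snd t) Z"
  obtain x \<rho> y \<sigma> where [simp]: "s = (x, \<rho>)" "t = (y, \<sigma>)" by (cases s, cases t)
  have s: "(a, x) \<in> (rotor_edges \<rho> Z)\<^sup>*" "x \<in> Z" "rotor_of (rotor_edges \<rho> Z) = \<rho>"
    using dead_forest[of x \<rho> Z] st by auto
  have t: "(a, y) \<in> (rotor_edges \<rho> Z)\<^sup>*" "y \<in> Z" "rotor_of (rotor_edges \<rho> Z) = \<sigma>"
    using dead_forest[of y \<sigma> Z] st by auto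
  have "(x, y) \<in> (rotor_edges \<rho> Z)\<^sup>* \<or> (y, x) \<in> (rotor_edges \<rho> Z)\<^sup>*"
    by (rule single_valued_path_linear[OF single_valued_rotor_edges s(1) t(1)])
  then have "x = y"
    using rtrancl_from_sink[OF rotor_edges_Image[OF s(2)]] rtrancl_from_sink[OF rotor_edges_Image[OF t(2)]]
    by auto
  then show "s = t" using s(3) t(3) by simp
qed

text \<open>
  A count: the step is injective on live states, never hits a start, and there are no more dead
  states than starts.
\<close>

lemma step_surj:
  assumes fin: "finite (- Z)" and a: "a \<notin> Z"
  shows "live Z - starts Z \<subseteq> rotor_step \<tau> ` live Z"
proof -
  let ?T = "(live Z - starts Z) \<union> dead Z"
  have finL: "finite (live Z)" by (rule finite_live[OF fin])
  have dead_sub: "(\<lambda>s. rotor_edges (snd s) Z) ` dead Z \<subseteq> forests Z"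
  proof (rule image_subsetI)
    fix s assume "s \<in> dead Z"
    then show "rotor_edges (snd s) Z \<in> forests Z"
      using dead_forest(1)[of "fst s" "snd s" Z] by simp
  qed
  have finD: "finite (dead Z)"
    by (rule finite_imageD[OF finite_subset[OF dead_sub finite_forests[OF fin]] dead_inj])
  have cardD: "card (dead Z) \<le> card (starts Z)"
    unfolding card_starts by (rule card_inj_on_le[OF dead_inj dead_sub finite_forests[OF fin]])
  have sub: "rotor_step \<tau> ` live Z \<subseteq> ?T"
  proof (rule image_subsetI)
    fix s assume s: "s \<in> live Z"
    then show "rotor_step \<tau> s \<in> ?T"
      using step_in_states[OF s] step_not_start[OF s] by blast
  qed
  have "card (rotor_step \<tau> ` live Z) = card (live Z)"
    by (rule card_image) (use step_inj in \<open>blast intro: inj_onI\<close>)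
  moreover have "card ?T = card (live Z - starts Z) + card (dead Z)"
    by (rule card_Un_disjoint) (use finL finD in auto)
  moreover have "card (live Z - starts Z) = card (live Z) - card (starts Z)"
    using starts_live[OF a] finL by (meson card_Diff_subset finite_subset)
  moreover have "card (starts Z) \<le> card (live Z)"
    using starts_live[OF a] finL by (rule card_mono[rotated])
  ultimately have "card ?T \<le> card (rotor_step \<tau> ` live Z)"
    using cardD by linarith
  then have "rotor_step \<tau> ` live Z = ?T"
    using sub finL finD by (intro card_seteq) auto
  then show ?thesis by blast
qed

section \<open>Reaching the sink\<close>

lemma rotor_walk_Suc:
  assumes "(rotor_step \<tau> ^^ t) (x, \<rho>) = (y, \<sigma>)"
  shows "(rotor_step \<tau> ^^ Suc t) (x, \<rho>) = (\<tau> y (\<sigma> y), \<sigma>(y := \<tau> y (\<sigma> y)))"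
  using assms by simp

text \<open>A vertex visited infinitely often sends the walk to each neighbour infinitely often,
  because its mechanism has a single orbit. A walk confined to the finite set \<open>- Z\<close> has
  such a vertex, and connectivity carries the property into \<open>Z\<close>.\<close>

lemma rotor_walk_leaves:
  assumes fin: "finite (- Z)" and ne: "Z \<noteq> {}" and \<rho>: "\<And>y. y \<notin> Z \<Longrightarrow> (y, \<rho> y) \<in> E"
  shows "\<exists>t. fst ((rotor_step \<tau> ^^ t) (x, \<rho>)) \<in> Z"
proof (rule ccontr)
  assume "\<not> ?thesis"
  then have stay: "fst ((rotor_step \<tau> ^^ t) (x, \<rho>)) \<notin> Z" for t by blast
  define X where "X t = fst ((rotor_step \<tau> ^^ t) (x, \<rho>))" for t
  define \<Phi> where "\<Phi> t = snd ((rotor_step \<tau> ^^ t) (x, \<rho>))" for t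
  have X: "X t \<notin> Z" for t using stay by (simp add: X_def)
  have st: "(rotor_step \<tau> ^^ t) (x, \<rho>) = (X t, \<Phi> t)" for t by (simp add: X_def \<Phi>_def)
  have XS: "X (Suc t) = \<tau> (X t) (\<Phi> t (X t))" and \<Phi>S: "\<Phi> (Suc t) = (\<Phi> t)(X t := X (Suc t))" for t
    using rotor_walk_Suc[OF st[of t]] st[of "Suc t"] by auto
  have \<Phi>_E: "(y, \<Phi> t y) \<in> E" if "y \<notin> Z" for t y
  proof (induction t)
    case 0
    then show ?case using \<rho> that by (simp add: \<Phi>_def)
  next
    case (Suc t)
    then show ?case by (cases "y = X t") (auto simp: \<Phi>S XS rotor_next)
  qed
  define io where "io y \<longleftrightarrow> (\<forall>n. \<exists>t\<ge>n. X t = y)" for y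
  have "\<exists>y. io y"
  proof (rule ccontr)
    assume "\<nexists>y. io y"
    then obtain n where n: "\<And>y t. n y \<le> t \<Longrightarrow> X t \<noteq> y"
      unfolding io_def by metis
    \<comment> \<open>From the maximum of the bounds \<open>n\<close> on, no vertex of
      \<open>- Z\<close> is visited any more.\<close>
    have "n (X (Max (n ` (- Z)))) \<le> Max (n ` (- Z))"
      using fin X by (intro Max_ge) auto
    from n[OF this] show False by simp
  qed
  moreover have "io q" if "io y" "(y, q) \<in> E" for y q
    unfolding io_def
  proof
    fix n
    have "y \<notin> Z" using X \<open>io y\<close> unfolding io_def by metis
    obtain t0 where t0: "t0 \<ge> n" "X t0 = y" using \<open>io y\<close> unfolding io_def by blast
    have ex: "\<exists>t\<ge>n. X t = y \<and> \<Phi> t y = (\<tau> y ^^ i) (\<Phi> t0 y)" for i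
    proof (induction i)
      case 0
      show ?case using t0 by auto
    next
      case (Suc i)
      then obtain t where t: "t \<ge> n" "X t = y" "\<Phi> t y = (\<tau> y ^^ i) (\<Phi> t0 y)" by blast
      \<comment> \<open>Up to its next visit the rotor at \<open>y\<close> is unchanged, so
        successive visits see successive iterates of the mechanism.\<close>
      define t' where "t' = (LEAST t'. Suc t \<le> t' \<and> X t' = y)"
      have t': "Suc t \<le> t' \<and> X t' = y"
        unfolding t'_def by (rule LeastI_ex) (use \<open>io y\<close> in \<open>auto simp: io_def\<close>)
      have not: "X r \<noteq> y" if "Suc t \<le> r" "r < t'" for r
        using not_less_Least[of r "\<lambda>t'. Suc t \<le> t' \<and> X t' = y"] that by (auto simp: t'_def)
      have "\<Phi> r y = \<Phi> (Suc t) y" if "Suc t \<le> r" "r \<le> t'" for r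
        using that
      proof (induction r rule: dec_induct)
        case (step r)
        then show ?case using not[of r] by (simp add: \<Phi>S)
      qed simp
      then have "\<Phi> t' y = \<Phi> (Suc t) y" using t' by blast
      then have "\<Phi> t' y = (\<tau> y ^^ Suc i) (\<Phi> t0 y)" using t by (simp add: \<Phi>S XS)
      then show ?case using t' t(1) by (intro exI[of _ t']) simp
    qed
    \<comment> \<open>The rotor advances before the walker moves, so the orbit is taken from the
      advanced rotor.\<close>
    have "\<tau> y (\<Phi> t0 y) \<in> E `` {y}" using rotor_next[OF \<Phi>_E[OF \<open>y \<notin> Z\<close>]] by simp
    then have "{(\<tau> y ^^ i) (\<tau> y (\<Phi> t0 y)) | i. True} = E `` {y}"
      using mechanism[of y] by (auto simp: local_mechanism_def)
    then obtain i where "q = (\<tau> y ^^ i) (\<tau> y (\<Phi> t0 y))" using \<open>(y, q) \<in> E\<close> by blast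
    then have i: "q = \<tau> y ((\<tau> y ^^ i) (\<Phi> t0 y))" by (simp add: funpow_swap1)
    obtain t where "t \<ge> n" "X t = y" "\<Phi> t y = (\<tau> y ^^ i) (\<Phi> t0 y)" using ex by blast
    then have "X (Suc t) = q" by (simp add: XS i)
    moreover have "n \<le> Suc t" using \<open>t \<ge> n\<close> by simp
    ultimately show "\<exists>t\<ge>n. X t = q" by blast
  qed
  ultimately obtain y where "io y" and nbr: "\<And>y q. io y \<Longrightarrow> (y, q) \<in> E \<Longrightarrow> io q" by blast
  obtain z where "z \<in> Z" using ne by blast
  have "io z" using conn[of y z] by (induction rule: rtrancl_induct) (use \<open>io y\<close> nbr in auto)
  then show False using X \<open>z \<in> Z\<close> unfolding io_def by metis
qed

lemma live_rotor: "(x, \<rho>) \<in> live Z \<Longrightarrow> y \<notin> Z \<Longrightarrow> (y, \<rho> y) \<in> E"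
  by (cases "y = x") (auto simp: states_def oriented_forest_def dest!: subsetD[of "rotor_edges \<rho> _" E "(y, \<rho> y)"])

text \<open>A set of live states not reached from the starts would be mapped onto itself by the step.\<close>

lemma live_reached:
  assumes fin: "finite (- Z)" and ne: "Z \<noteq> {}" and a: "a \<notin> Z" and s: "s \<in> live Z"
  shows "\<exists>s0\<in>starts Z. \<exists>t. s = (rotor_step \<tau> ^^ t) s0 \<and> (\<forall>r\<le>t. (rotor_step \<tau> ^^ r) s0 \<in> live Z)"
proof (rule ccontr)
  define P where "P s \<longleftrightarrow> (\<exists>s0\<in>starts Z. \<exists>t. s = (rotor_step \<tau> ^^ t) s0 \<and> (\<forall>r\<le>t. (rotor_step \<tau> ^^ r) s0 \<in> live Z))" for s
  assume "\<not> ?thesis"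
  then have "\<not> P s" by (simp add: P_def)
  define K where "K = {s \<in> live Z. \<not> P s}"
  have "s \<in> K" using s \<open>\<not> P s\<close> by (simp add: K_def)
  have finK: "finite K" unfolding K_def by (rule finite_subset[OF _ finite_live[OF fin]]) auto
  have "K \<subseteq> rotor_step \<tau> ` K"
  proof
    fix k assume k: "k \<in> K"
    have "P k" if "k \<in> starts Z"
      unfolding P_def
    proof (rule bexI[OF _ that], rule exI[of _ 0])
      show "k = (rotor_step \<tau> ^^ 0) k \<and> (\<forall>r\<le>0. (rotor_step \<tau> ^^ r) k \<in> live Z)"
        using subsetD[OF starts_live[OF a] that] by simp
    qed
    then have "k \<in> live Z - starts Z" using k by (auto simp: K_def)
    then obtain p where p: "p \<in> live Z" "k = rotor_step \<tau> p" using step_surj[OF fin a] by blast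
    have "\<not> P p"
    proof
      assume "P p"
      then obtain s0 t where t: "s0 \<in> starts Z" "p = (rotor_step \<tau> ^^ t) s0" "\<forall>r\<le>t. (rotor_step \<tau> ^^ r) s0 \<in> live Z"
        unfolding P_def by blast
      have "k = (rotor_step \<tau> ^^ Suc t) s0" using p t by simp
      moreover have "\<forall>r\<le>Suc t. (rotor_step \<tau> ^^ r) s0 \<in> live Z"
        using t(3) k calculation by (auto simp: le_Suc_eq K_def)
      ultimately have "P k" unfolding P_def using t(1) by blast
      then show False using k by (simp add: K_def)
    qed
    then show "k \<in> rotor_step \<tau> ` K" using p by (auto simp: K_def)
  qed
  then have "rotor_step \<tau> ` K = K"
    using finK card_seteq[OF finite_imageI[OF finK]] card_image_le[OF finK] by metis
  then have "(rotor_step \<tau> ^^ t) s \<in> K" for t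
    by (induction t) (use \<open>s \<in> K\<close> in auto)
  then have "fst ((rotor_step \<tau> ^^ t) s) \<notin> Z" for t by (auto simp: K_def)
  moreover have "\<exists>t. fst ((rotor_step \<tau> ^^ t) s) \<in> Z"
    using rotor_walk_leaves[OF fin ne live_rotor[of "fst s" "snd s" Z], of "fst s"] s by simp
  ultimately show False by blast
qed

section \<open>Visits as rooted forests with a rotor\<close>

definition visit_times :: "'v set \<Rightarrow> ('v \<Rightarrow> 'v) \<Rightarrow> 'v \<Rightarrow> nat set" where
  "visit_times Z \<rho> x = {t. rotor_walk \<tau> a \<rho> t = x \<and> (\<forall>s\<le>t. rotor_walk \<tau> a \<rho> s \<notin> Z)}"

lemma finite_visit_times:
  assumes "finite (- Z)" "Z \<noteq> {}" "\<And>y. y \<notin> Z \<Longrightarrow> (y, \<rho> y) \<in> E"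
  shows "finite (visit_times Z \<rho> x)"
proof -
  obtain t where t: "fst ((rotor_step \<tau> ^^ t) (a, \<rho>)) \<in> Z"
    using rotor_walk_leaves[OF assms] by blast
  have "visit_times Z \<rho> x \<subseteq> {..<t}"
  proof
    fix s assume "s \<in> visit_times Z \<rho> x"
    then show "s \<in> {..<t}"
      using t by (auto simp: visit_times_def rotor_walk_def not_le[symmetric])
  qed
  then show ?thesis by (rule finite_subset) simp
qed

lemma walk_live:
  assumes "F \<in> forests Z" "\<forall>s\<le>t. rotor_walk \<tau> a (rotor_of F) s \<notin> Z"
  shows "(rotor_step \<tau> ^^ t) (a, rotor_of F) \<in> live Z"
  using assms(2)
proof (induction t)
  case 0
  then show ?case using assms(1) starts_live[of Z] by (auto simp: rotor_walk_def)
next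
  case (Suc t)
  then have "(rotor_step \<tau> ^^ t) (a, rotor_of F) \<in> live Z" by simp
  from step_in_states[OF this] Suc.prems show ?case by (auto simp: rotor_walk_def)
qed

text \<open>The rotor of a visited vertex is its last exit, and following last exits leads to the
  current location; \<open>reach_step\<close> maintains this.\<close>

lemma walk_visited:
  assumes "F \<in> forests Z" "\<forall>s\<le>t. rotor_walk \<tau> a (rotor_of F) s \<notin> Z"
    and "(rotor_step \<tau> ^^ t) (a, rotor_of F) = (x, \<rho>)" and "r \<le> t"
  shows "(rotor_walk \<tau> a (rotor_of F) r, x) \<in> (rotor_edges \<rho> (insert x Z))\<^sup>*"
  using assms(2-)
proof (induction t arbitrary: x \<rho>)
  case 0
  then show ?case by (simp add: rotor_walk_def)
next
  case (Suc t)
  show ?case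
  proof (cases "r = Suc t")
    case True
    then show ?thesis using Suc.prems by (simp add: rotor_walk_def)
  next
    case False
    obtain y \<sigma> where y: "(rotor_step \<tau> ^^ t) (a, rotor_of F) = (y, \<sigma>)" by fastforce
    have lv: "(y, \<sigma>) \<in> live Z" using walk_live[OF assms(1), of t] Suc.prems y by simp
    then have "y \<notin> Z" by simp
    have x: "x = \<tau> y (\<sigma> y)" and \<rho>: "\<rho> = \<sigma>(y := x)"
      using rotor_walk_Suc[OF y] Suc.prems(2) by auto
    have "(y, x) \<in> E" unfolding x by (intro rotor_next live_rotor[OF lv \<open>y \<notin> Z\<close>])
    then have "y \<noteq> x" by auto
    have "(rotor_walk \<tau> a (rotor_of F) r, y) \<in> (rotor_edges \<sigma> (insert y Z))\<^sup>*"
      by (rule Suc.IH[OF _ y]) (use Suc.prems False in auto)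
    from reach_step[OF \<open>y \<notin> Z\<close> \<open>y \<noteq> x\<close> this] show ?thesis by (simp only: \<rho>)
  qed
qed

abbreviation rooted_states :: "'v set \<Rightarrow> 'v \<Rightarrow> (('v \<times> 'v) set \<times> 'v) set" where
  "rooted_states Z x \<equiv> {F \<in> forests (insert x Z). (a, x) \<in> F\<^sup>*} \<times> E `` {x}"

text \<open>The rotor at the current location \<open>x\<close> is kept apart from the forest because
  it can be any neighbour of \<open>x\<close>; this is the origin of the factor
  \<open>deg x\<close>.\<close>

definition encode :: "'v set \<Rightarrow> ('v \<times> 'v) set \<times> nat \<Rightarrow> ('v \<times> 'v) set \<times> 'v" where
  "encode Z = (\<lambda>(F, t). let (x, \<rho>) = (rotor_step \<tau> ^^ t) (a, rotor_of F)
     in (rotor_edges \<rho> (insert x Z), \<rho> x))"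

text \<open>Run both walks backwards. The shorter one arrives at its start first, and a start has no
  live predecessor, so the times agree.\<close>

lemma step_funpow_inj:
  assumes "s1 \<in> starts Z" "s2 \<in> starts Z" "a \<notin> Z" "m \<le> n"
    and "\<forall>r\<le>m. (rotor_step \<tau> ^^ r) s1 \<in> live Z" "\<forall>r\<le>n. (rotor_step \<tau> ^^ r) s2 \<in> live Z"
    and "(rotor_step \<tau> ^^ m) s1 = (rotor_step \<tau> ^^ n) s2"
  shows "s1 = s2 \<and> m = n"
  using assms(4-)
proof (induction m arbitrary: n)
  case 0
  show ?case
  proof (cases n)
    case (Suc k)
    then have "(rotor_step \<tau> ^^ k) s2 \<in> live Z" "rotor_step \<tau> ((rotor_step \<tau> ^^ k) s2) = s1"
      using 0 by auto
    then show ?thesis using step_not_start[of "(rotor_step \<tau> ^^ k) s2" Z] assms(1) by simp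
  qed (use 0 in simp)
next
  case (Suc m)
  then obtain k where k: "n = Suc k" by (cases n) auto
  have "(rotor_step \<tau> ^^ m) s1 = (rotor_step \<tau> ^^ k) s2"
    by (rule step_inj[of _ Z]) (use Suc.prems k in auto)
  then show ?case using Suc.IH[of k] Suc.prems k by auto
qed

lemma bij_encode:
  assumes fin: "finite (- Z)" and ne: "Z \<noteq> {}" and a: "a \<notin> Z" and x: "x \<notin> Z"
  shows "bij_betw (encode Z) (Sigma (forests Z) (\<lambda>F. visit_times Z (rotor_of F) x)) (rooted_states Z x)"
proof -
  let ?A = "Sigma (forests Z) (\<lambda>F. visit_times Z (rotor_of F) x)"
  let ?s = "\<lambda>(F, t). (rotor_step \<tau> ^^ t) (a, rotor_of F)"
  have fst_s: "fst (?s p) = x" if "p \<in> ?A" for p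
    using that by (auto simp: visit_times_def rotor_walk_def)
  have live_s: "(rotor_step \<tau> ^^ r) (a, rotor_of F) \<in> live Z" if "(F, t) \<in> ?A" "r \<le> t" for F t r
    using that by (intro walk_live) (auto simp: visit_times_def)
  have "inj_on ?s ?A"
  proof (rule inj_onI)
    fix p q assume pq: "p \<in> ?A" "q \<in> ?A" "?s p = ?s q"
    obtain F t G u where [simp]: "p = (F, t)" "q = (G, u)" by (cases p, cases q)
    have "(a, rotor_of F) = (a, rotor_of G) \<and> t = u"
    proof (cases "t \<le> u")
      case True
      show ?thesis
        by (rule step_funpow_inj[of _ Z]) (use pq live_s a True in auto)
    next
      case False
      have "(a, rotor_of G) = (a, rotor_of F) \<and> u = t"
        by (rule step_funpow_inj[of _ Z]) (use pq live_s a False in auto)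
      then show ?thesis by auto
    qed
    then show "p = q"
      using inj_on_rotor_of[of Z] pq by (auto dest: inj_onD)
  qed
  moreover have "?s ` ?A = {s \<in> live Z. fst s = x}"
  proof (intro subset_antisym subsetI)
    fix s assume "s \<in> ?s ` ?A"
    then show "s \<in> {s \<in> live Z. fst s = x}" using fst_s live_s x by auto
  next
    fix s assume s: "s \<in> {s \<in> live Z. fst s = x}"
    then obtain F t where "F \<in> forests Z" and t: "s = (rotor_step \<tau> ^^ t) (a, rotor_of F)"
      "\<forall>r\<le>t. (rotor_step \<tau> ^^ r) (a, rotor_of F) \<in> live Z"
      using live_reached[OF fin ne a, of s] by auto
    then have "(F, t) \<in> ?A" using s by (auto simp: visit_times_def rotor_walk_def)
    then show "s \<in> ?s ` ?A" using t(1) by force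
  qed
  ultimately have "bij_betw ?s ?A {s \<in> live Z. fst s = x}" by (simp add: bij_betw_def)
  moreover have "bij_betw (\<lambda>(x, \<rho>). (rotor_edges \<rho> (insert x Z), \<rho> x)) {s \<in> live Z. fst s = x} (rooted_states Z x)"
  proof (rule bij_betw_byWitness[where f' = "\<lambda>(F, v). (x, (rotor_of F)(x := v))"])
    have same: "rotor_edges (\<rho>(x := v)) (insert x Z) = rotor_edges \<rho> (insert x Z)" for \<rho> v by auto
    show "\<forall>s\<in>{s \<in> live Z. fst s = x}. (case case s of (x, \<rho>) \<Rightarrow> (rotor_edges \<rho> (insert x Z), \<rho> x) of
        (F, v) \<Rightarrow> (x, (rotor_of F)(x := v))) = s"
    proof
      fix s assume s: "s \<in> {s \<in> live Z. fst s = x}"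
      then obtain \<rho> where s': "s = (x, \<rho>)" by (cases s) auto
      have "(rotor_of (rotor_edges \<rho> (insert x Z)))(x := \<rho> x) = \<rho>"
      proof
        fix y show "((rotor_of (rotor_edges \<rho> (insert x Z)))(x := \<rho> x)) y = \<rho> y"
          using s by (cases "y \<in> Z") (auto simp: s' states_def rotor_of_def)
      qed
      then show "(case case s of (x, \<rho>) \<Rightarrow> (rotor_edges \<rho> (insert x Z), \<rho> x) of
        (F, v) \<Rightarrow> (x, (rotor_of F)(x := v))) = s" by (simp add: s')
    qed
    show "\<forall>p\<in>rooted_states Z x. (case case p of (F, v) \<Rightarrow> (x, (rotor_of F)(x := v)) of
        (x, \<rho>) \<Rightarrow> (rotor_edges \<rho> (insert x Z), \<rho> x)) = p"
      by (auto simp: same rotor_edges_rotor_of)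
    show "(\<lambda>(x, \<rho>). (rotor_edges \<rho> (insert x Z), \<rho> x)) ` {s \<in> live Z. fst s = x} \<subseteq> rooted_states Z x"
      by (auto simp: states_def)
    show "(\<lambda>(F, v). (x, (rotor_of F)(x := v))) ` rooted_states Z x \<subseteq> {s \<in> live Z. fst s = x}"
      using x by (auto simp: states_def same rotor_edges_rotor_of rotor_of_sink)
  qed
  ultimately have "bij_betw ((\<lambda>(x, \<rho>). (rotor_edges \<rho> (insert x Z), \<rho> x)) \<circ> ?s) ?A (rooted_states Z x)"
    by (rule bij_betw_trans)
  then show ?thesis
    by (rule bij_betw_cong[THEN iffD1, rotated]) (auto simp: encode_def)
qed

lemma finite_visit_times_forest:
  assumes "finite (- Z)" "Z \<noteq> {}" "Z \<subseteq> Y" "F \<in> forests Z"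
  shows "finite (visit_times Y (rotor_of F) x)"
proof (rule finite_visit_times)
  show "finite (- Y)" using assms by (auto intro: finite_subset)
  show "Y \<noteq> {}" using assms by auto
  fix y assume "y \<notin> Y"
  then have "(y, rotor_of F y) \<in> rotor_edges (rotor_of F) Z" using assms by auto
  then show "(y, rotor_of F y) \<in> E"
    using rotor_edges_rotor_of[of Z F] assms by (auto simp: oriented_forest_def)
qed

lemma sum_visits_forests:
  assumes fin: "finite (- Z)" and ne: "Z \<noteq> {}" and a: "a \<notin> Z" and x: "x \<notin> Z"
  shows "(\<Sum>F\<in>forests Z. real (card (visit_times Z (rotor_of F) x))) = deg x * linked Z x a"
proof -
  let ?A = "Sigma (forests Z) (\<lambda>F. visit_times Z (rotor_of F) x)"
  have "(\<Sum>F\<in>forests Z. card (visit_times Z (rotor_of F) x)) = card ?A"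
    by (rule card_SigmaI[symmetric]) (use finite_forests[OF fin] finite_visit_times_forest[OF fin ne] in auto)
  also have "\<dots> = card (rooted_states Z x)"
    by (rule bij_betw_same_card[OF bij_encode[OF assms]])
  also have "\<dots> = card {F \<in> forests (insert x Z). (a, x) \<in> F\<^sup>*} * deg x"
    by (rule card_cartesian_product)
  finally have "(\<Sum>F\<in>forests Z. real (card (visit_times Z (rotor_of F) x)))
      = deg x * card {F \<in> forests (insert x Z). (a, x) \<in> F\<^sup>*}"
    by (simp flip: of_nat_sum add: mult.commute)
  then show ?thesis by (simp add: linked_card[OF fin])
qed

text \<open>
  At a late visit to \<open>x\<close> the walk has already been in \<open>Y\<close>, and the last exits lead from there to \<open>x\<close>.
\<close>

lemma sum_late_visits:
  assumes fin: "finite (- Z)" and ne: "Z \<noteq> {}" and a: "a \<notin> Z" and x: "x \<notin> Z" and "Z \<subseteq> Y"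
  shows "(\<Sum>F\<in>forests Z. real (card (visit_times Z (rotor_of F) x)) - card (visit_times Y (rotor_of F) x))
    \<le> deg x * card {F \<in> forests (insert x Z). \<exists>w\<in>Y. (w, x) \<in> F\<^sup>*}"
proof -
  let ?V = "\<lambda>Z F. visit_times Z (rotor_of F) x"
  let ?A = "Sigma (forests Z) (\<lambda>F. ?V Z F - ?V Y F)"
  let ?B = "{F \<in> forests (insert x Z). \<exists>w\<in>Y. (w, x) \<in> F\<^sup>*}"
  have finF: "finite (forests (insert x Z))"
    by (rule finite_forests) (use fin in \<open>auto intro: finite_subset\<close>)
  have sub: "?V Y F \<subseteq> ?V Z F" for F using \<open>Z \<subseteq> Y\<close> by (auto simp: visit_times_def)
  have fin_V: "finite (?V Z F)" if "F \<in> forests Z" for F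
    by (rule finite_visit_times_forest[OF fin ne order_refl that])
  have "(\<Sum>F\<in>forests Z. real (card (?V Z F)) - card (?V Y F)) = (\<Sum>F\<in>forests Z. real (card (?V Z F - ?V Y F)))"
  proof (rule sum.cong[OF refl])
    fix F assume "F \<in> forests Z"
    then have "finite (?V Z F)" by (rule fin_V)
    then show "real (card (?V Z F)) - card (?V Y F) = real (card (?V Z F - ?V Y F))"
      using card_Diff_subset[OF finite_subset[OF sub] sub] card_mono[OF _ sub] by (simp add: of_nat_diff)
  qed
  also have "\<dots> = card ?A"
    using finite_forests[OF fin] fin_V by (subst card_SigmaI) auto
  also have "\<dots> \<le> card (?B \<times> E `` {x})"
  proof (rule of_nat_mono, rule card_inj_on_le)
    have A: "?A \<subseteq> Sigma (forests Z) (?V Z)" by auto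
    show "inj_on (encode Z) ?A"
      by (rule inj_on_subset[OF _ A]) (use bij_encode[OF fin ne a x] in \<open>simp add: bij_betw_def\<close>)
    show "encode Z ` ?A \<subseteq> ?B \<times> E `` {x}"
    proof (rule image_subsetI)
      fix p assume p: "p \<in> ?A"
      obtain F t where p': "p = (F, t)" by (cases p)
      obtain y \<rho> where y: "(rotor_step \<tau> ^^ t) (a, rotor_of F) = (y, \<rho>)" by fastforce
      have F: "F \<in> forests Z" and t: "t \<in> ?V Z F" "t \<notin> ?V Y F" using p by (auto simp: p')
      then have "y = x" using y by (simp add: visit_times_def rotor_walk_def)
      have enc: "encode Z p = (rotor_edges \<rho> (insert x Z), \<rho> x)"
        using y by (simp add: encode_def p' \<open>y = x\<close>)
      have "encode Z p \<in> rooted_states Z x"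
        using bij_betwE[OF bij_encode[OF fin ne a x]] p A by blast
      moreover obtain r where r: "r \<le> t" "rotor_walk \<tau> a (rotor_of F) r \<in> Y"
        using t by (auto simp: visit_times_def)
      have "(rotor_walk \<tau> a (rotor_of F) r, x) \<in> (rotor_edges \<rho> (insert x Z))\<^sup>*"
        by (rule walk_visited[OF F _ _ r(1)]) (use t y \<open>y = x\<close> in \<open>auto simp: visit_times_def\<close>)
      ultimately show "encode Z p \<in> ?B \<times> E `` {x}"
        using r(2) by (auto simp: enc)
    qed
    show "finite (?B \<times> E `` {x})" using finF by simp
  qed
  also have "\<dots> = deg x * card ?B" by (simp add: card_cartesian_product mult.commute)
  finally show ?thesis .
qed

end

section \<open>The wired spanning forest\<close>

lemma trancl_finite_subset:
  assumes "(x, y) \<in> F\<^sup>+"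
  shows "\<exists>B. finite B \<and> B \<subseteq> F \<and> (x, y) \<in> B\<^sup>+"
  using assms
proof (induction rule: trancl_induct)
  case (base y)
  then show ?case by (intro exI[of _ "{(x, y)}"]) auto
next
  case (step y z)
  then obtain B where B: "finite B" "B \<subseteq> F" "(x, y) \<in> B\<^sup>+" by blast
  have "B\<^sup>+ \<subseteq> (insert (y, z) B)\<^sup>+" by (rule trancl_mono_subset) blast
  then have "(x, z) \<in> (insert (y, z) B)\<^sup>+"
    using B(3) by (meson insertI1 subsetD trancl.trancl_into_trancl)
  then show ?case using B step by (intro exI[of _ "insert (y, z) B"]) auto
qed

lemma rtrancl_finite_subset:
  assumes "(x, y) \<in> F\<^sup>*"
  shows "\<exists>B. finite B \<and> B \<subseteq> F \<and> (x, y) \<in> B\<^sup>*"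
proof (cases "x = y")
  case True
  then show ?thesis by (intro exI[of _ "{}"]) auto
next
  case False
  then have "(x, y) \<in> F\<^sup>+" using assms by (simp add: rtrancl_eq_or_trancl)
  then show ?thesis using trancl_finite_subset by (meson trancl_into_rtrancl)
qed

lemma iterate_trancl:
  fixes f :: "nat \<Rightarrow> 'v"
  assumes "\<And>n. (f n, f (Suc n)) \<in> R"
  shows "(f m, f (Suc (m + k))) \<in> R\<^sup>+"
proof (induction k)
  case 0
  then show ?case using assms[of m] by auto
next
  case (Suc k)
  then show ?case using assms[of "Suc (m + k)"] by (simp add: trancl.trancl_into_trancl)
qed

lemma iterate_inj:
  fixes f :: "nat \<Rightarrow> 'v"
  assumes "\<And>n. (f n, f (Suc n)) \<in> R" "acyclic R"
  shows "inj f"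
proof (rule linorder_injI)
  fix m n :: nat assume "m < n"
  then obtain k where "n = Suc (m + k)" using less_imp_Suc_add by blast
  then have "(f m, f n) \<in> R\<^sup>+" using iterate_trancl[of f R m k] assms(1) by simp
  then show "f m \<noteq> f n" using assms(2) by (auto simp: acyclic_def)
qed

section \<open>Finite pasts and local events\<close>

context lgraph begin

text \<open>The step of Koenig's lemma: by local finiteness the past of \<open>q\<close> consists of
  \<open>q\<close> and finitely many pasts of predecessors.\<close>

lemma infinite_past_predecessor:
  assumes "F \<subseteq> E" "infinite {w. (w, q) \<in> F\<^sup>*}"
  shows "\<exists>r. (r, q) \<in> F \<and> infinite {w. (w, r) \<in> F\<^sup>*}"
proof (rule ccontr)
  assume "\<not> ?thesis"
  then have fin: "finite {w. (w, r) \<in> F\<^sup>*}" if "(r, q) \<in> F" for r using that by blast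
  have sub: "{w. (w, q) \<in> F\<^sup>*} \<subseteq> insert q (\<Union>r\<in>{r. (r, q) \<in> F}. {w. (w, r) \<in> F\<^sup>*})"
  proof
    fix w assume "w \<in> {w. (w, q) \<in> F\<^sup>*}"
    then have "(w, q) \<in> F\<^sup>*" by simp
    then show "w \<in> insert q (\<Union>r\<in>{r. (r, q) \<in> F}. {w. (w, r) \<in> F\<^sup>*})"
      by (cases rule: rtranclE) auto
  qed
  have "{r. (r, q) \<in> F} \<subseteq> E `` {q}" using assms(1) edge_sym by blast
  then have "finite {r. (r, q) \<in> F}" by (rule finite_subset) simp
  then have "finite {w. (w, q) \<in> F\<^sup>*}"
    using fin by (intro finite_subset[OF sub]) simp
  then show False using assms(2) by simp
qed

text \<open>An infinite past contains a backward ray, which together with the forward ray gives two ends.\<close>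

lemma finite_past:
  assumes FE: "F \<subseteq> E" and out: "\<forall>x. \<exists>y. (x, y) \<in> F" and acyc: "acyclic F"
    and ends: "\<forall>C \<in> components F. card (ends F C) = 1"
  shows "finite {w. (w, p) \<in> F\<^sup>*}"
proof (rule ccontr)
  assume inf: "infinite {w. (w, p) \<in> F\<^sup>*}"
  \<comment> \<open>Each step backwards keeps the past infinite; the clause for \<open>n = 0\<close>
    makes the ray start at \<open>p\<close>.\<close>
  have "\<exists>q. \<forall>n. (infinite {w. (w, q n) \<in> F\<^sup>*} \<and> (n = 0 \<longrightarrow> q n = p)) \<and> (q (Suc n), q n) \<in> F"
  proof (rule dependent_nat_choice)
    show "\<exists>x. infinite {w. (w, x) \<in> F\<^sup>*} \<and> (0 = (0::nat) \<longrightarrow> x = p)" using inf by blast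
    fix x and n :: nat assume "infinite {w. (w, x) \<in> F\<^sup>*} \<and> (n = 0 \<longrightarrow> x = p)"
    then obtain r where "(r, x) \<in> F" "infinite {w. (w, r) \<in> F\<^sup>*}"
      using infinite_past_predecessor[OF FE, of x] by blast
    then show "\<exists>y. (infinite {w. (w, y) \<in> F\<^sup>*} \<and> (Suc n = 0 \<longrightarrow> y = p)) \<and> (y, x) \<in> F" by blast
  qed
  then obtain q where q: "q 0 = p" "\<And>n. (q (Suc n), q n) \<in> F" by blast
  obtain \<sigma> where \<sigma>: "\<And>x. (x, \<sigma> x) \<in> F" using out by metis
  define f where "f n = (\<sigma> ^^ n) p" for n
  have f: "f 0 = p" "\<And>n. (f n, f (Suc n)) \<in> F" by (auto simp: f_def \<sigma>)
  have inj_f: "inj f" by (rule iterate_inj[of f F]) (use f(2) acyc in auto)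
  have inj_q: "inj q"
    by (rule iterate_inj[of q "F\<inverse>"]) (use q acyc in \<open>auto simp: acyclic_converse\<close>)
  define C where "C = (unoriented F)\<^sup>* `` {p}"
  have C: "C \<in> components F" by (auto simp: C_def components_def quotient_def)
  have fC: "f n \<in> C" for n
  proof (induction n)
    case (Suc n)
    have "(f n, f (Suc n)) \<in> unoriented F" using f(2) by (simp add: unoriented_def)
    with Suc show ?case unfolding C_def by (simp add: rtrancl_into_rtrancl)
  qed (simp add: C_def f)
  have qC: "q n \<in> C" for n
  proof (induction n)
    case (Suc n)
    have "(q n, q (Suc n)) \<in> unoriented F" using q(2) by (simp add: unoriented_def)
    with Suc show ?case unfolding C_def by (simp add: rtrancl_into_rtrancl)
  qed (simp add: C_def q)
  have rf: "f \<in> rays F C" using inj_f fC f(2) by (auto simp: rays_def unoriented_def)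
  have rq: "q \<in> rays F C" using inj_q qC q(2) by (auto simp: rays_def unoriented_def)
  let ?R = "{(p, q). p \<in> rays F C \<and> q \<in> rays F C \<and>
        finite ((range p - range q) \<union> (range q - range p))}"
  have "?R `` {f} \<in> ends F C" "?R `` {q} \<in> ends F C"
    unfolding ends_def by (rule quotientI[OF rf], rule quotientI[OF rq])
  moreover obtain X where "ends F C = {X}"
    using ends C card_1_singletonE by blast
  ultimately have eq: "?R `` {f} = ?R `` {q}" by simp
  have "q \<in> ?R `` {q}" using rq by simp
  then have "q \<in> ?R `` {f}" unfolding eq .
  then have fin: "finite (range f - range q)" by simp
  \<comment> \<open>After \<open>p\<close> the forward ray never meets the backward one, as a common
    vertex would lead back to \<open>p\<close> and close a cycle.\<close>
  have "f ` {1..} \<subseteq> range f - range q"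
  proof (rule image_subsetI)
    fix m :: nat assume "m \<in> {1..}"
    have "f m \<notin> range q"
    proof
      assume "f m \<in> range q"
      then obtain n where n: "f m = q n" by blast
      obtain k where "m = Suc (0 + k)" using \<open>m \<in> {1..}\<close> by (cases m) auto
      then have "(p, f m) \<in> F\<^sup>+" using iterate_trancl[of f F 0 k] f by simp
      moreover have "(q n, p) \<in> F\<^sup>*"
        by (induction n) (use q in \<open>auto intro: converse_rtrancl_into_rtrancl\<close>)
      ultimately have "(p, p) \<in> F\<^sup>+" using n by simp
      then show False using acyc by (simp add: acyclic_def)
    qed
    then show "f m \<in> range f - range q" by simp
  qed
  then have "finite (f ` {1..})" using fin by (rule finite_subset)
  moreover have "infinite (f ` {1..})"
    using inj_f by (simp add: finite_image_iff inj_on_subset infinite_Ici)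
  ultimately show False by blast
qed

lemma countable_edges: "countable E"
proof (rule countable_subset)
  show "E \<subseteq> UNIV \<times> UNIV" by simp
  show "countable ((UNIV :: 'v set) \<times> (UNIV :: 'v set))"
    using countable_vertices by (intro countable_SIGMA)
qed

text \<open>After its last vertex in \<open>Y\<close>, a path to \<open>q\<close> uses only edges
  with an endpoint off \<open>Y\<close>. For cofinite \<open>Y\<close> there are finitely many such
  edges, so the event becomes local.\<close>

lemma past_meets_iff:
  assumes "F \<subseteq> E" "q \<notin> Y"
  shows "(\<exists>w\<in>Y. (w, q) \<in> F\<^sup>*) \<longleftrightarrow> (\<exists>w\<in>Y. (w, q) \<in> (F \<inter> {(u, v) \<in> E. u \<notin> Y \<or> v \<notin> Y})\<^sup>*)"
proof
  let ?F = "F \<inter> {(u, v) \<in> E. u \<notin> Y \<or> v \<notin> Y}"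
  assume "\<exists>w\<in>Y. (w, q) \<in> F\<^sup>*"
  then obtain w where w: "w \<in> Y" "(w, q) \<in> F\<^sup>*" by blast
  from w(2) have "(\<exists>w\<in>Y. (w, q) \<in> ?F\<^sup>*) \<or> w \<notin> Y \<and> (w, q) \<in> ?F\<^sup>*"
  proof (induction rule: converse_rtrancl_induct)
    case base
    then show ?case using assms by simp
  next
    case (step w v)
    show ?case
    proof (cases "\<exists>w\<in>Y. (w, q) \<in> ?F\<^sup>*")
      case False
      then have v: "v \<notin> Y" "(v, q) \<in> ?F\<^sup>*" using step(3) by blast+
      then have "(w, v) \<in> ?F" using step(1) assms by auto
      then have "(w, q) \<in> ?F\<^sup>*" using v by (meson converse_rtrancl_into_rtrancl)
      then show ?thesis by blast
    qed blast
  qed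
  then show "\<exists>w\<in>Y. (w, q) \<in> ?F\<^sup>*" using w by blast
next
  have "(F \<inter> {(u, v) \<in> E. u \<notin> Y \<or> v \<notin> Y})\<^sup>* \<subseteq> F\<^sup>*" by (rule rtrancl_mono) auto
  then show "\<exists>w\<in>Y. (w, q) \<in> (F \<inter> {(u, v) \<in> E. u \<notin> Y \<or> v \<notin> Y})\<^sup>* \<Longrightarrow> \<exists>w\<in>Y. (w, q) \<in> F\<^sup>*" by blast
qed

lemma finite_edges_meeting:
  assumes "finite (- Y)" shows "finite {(u, v) \<in> E. u \<notin> Y \<or> v \<notin> Y}"
proof -
  let ?D = "E \<inter> (- Y) \<times> UNIV"
  have "{(u, v) \<in> E. u \<notin> Y \<or> v \<notin> Y} \<subseteq> ?D \<union> ?D\<inverse>" using edge_sym by auto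
  moreover have "finite (?D \<union> ?D\<inverse>)" using finite_edges_from[OF assms] by simp
  ultimately show ?thesis by (rule finite_subset)
qed

end

text \<open>As \<open>K\<close> is finite, the function is a finite combination of indicators of the
  events \<open>g F \<inter> K = A\<close>, whatever \<open>f\<close> is.\<close>

lemma (in prob_space) integral_cylinder:
  fixes f :: "'b set \<Rightarrow> real"
  assumes "finite K" "\<And>A. A \<subseteq> K \<Longrightarrow> {F \<in> space M. g F \<inter> K = A} \<in> events"
  shows "integrable M (\<lambda>F. f (g F \<inter> K))"
    and "(\<integral>F. f (g F \<inter> K) \<partial>M) = (\<Sum>A\<in>Pow K. f A * prob {F \<in> space M. g F \<inter> K = A})"
proof -
  let ?C = "\<lambda>A. {F \<in> space M. g F \<inter> K = A}"
  have eq: "f (g F \<inter> K) = (\<Sum>A\<in>Pow K. f A * indicator (?C A) F)" if "F \<in> space M" for F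
  proof -
    have "(\<Sum>A\<in>Pow K. f A * indicator (?C A) F) = (\<Sum>A\<in>{g F \<inter> K}. f A * indicator (?C A) F)"
      by (rule sum.mono_neutral_right) (use assms(1) in \<open>auto simp: indicator_def\<close>)
    then show ?thesis using that by simp
  qed
  have int: "integrable M (\<lambda>F. f A * indicator (?C A) F)" if "A \<in> Pow K" for A
    using assms(2) that by (intro integrable_mult_right integrable_real_indicator) (auto simp: emeasure_eq_measure)
  have "integrable M (\<lambda>F. f (g F \<inter> K)) \<longleftrightarrow> integrable M (\<lambda>F. \<Sum>A\<in>Pow K. f A * indicator (?C A) F)"
    by (rule Bochner_Integration.integrable_cong[OF refl eq])
  then show "integrable M (\<lambda>F. f (g F \<inter> K))"
    using Bochner_Integration.integrable_sum[of "Pow K" M "\<lambda>A F. f A * indicator (?C A) F"] int by simp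
  have "(\<integral>F. f (g F \<inter> K) \<partial>M) = (\<integral>F. (\<Sum>A\<in>Pow K. f A * indicator (?C A) F) \<partial>M)"
    by (rule Bochner_Integration.integral_cong[OF refl eq])
  also have "\<dots> = (\<Sum>A\<in>Pow K. \<integral>F. f A * indicator (?C A) F \<partial>M)"
    by (rule Bochner_Integration.integral_sum) (rule int)
  also have "\<dots> = (\<Sum>A\<in>Pow K. f A * prob (?C A))"
  proof (rule sum.cong[OF refl])
    fix A assume "A \<in> Pow K"
    have "?C A \<inter> space M = ?C A" by auto
    then show "(\<integral>F. f A * indicator (?C A) F \<partial>M) = f A * prob (?C A)" by simp
  qed
  finally show "(\<integral>F. f (g F \<inter> K) \<partial>M) = (\<Sum>A\<in>Pow K. f A * prob (?C A))" .
qed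

section \<open>Events on finitely many edges and their limits\<close>

locale wsf_graph = transient_graph E for E :: "('v \<times> 'v) set" +
  fixes WSF :: "('v \<times> 'v) set measure"
  assumes wsf: "wired_spanning_forest E WSF"
begin

sublocale wsf: prob_space WSF
  using wsf by (simp add: wired_spanning_forest_def)

lemma space_WSF: "space WSF = Pow E"
proof -
  have "sets WSF = sets (subgraph_space E)" using wsf by (simp add: wired_spanning_forest_def)
  then have "space WSF = space (subgraph_space E)" by (rule sets_eq_imp_space_eq)
  then show ?thesis by (simp add: subgraph_space_def space_measure_of_conv)
qed

lemma edge_event: "{F \<in> space WSF. e \<in> F} \<in> wsf.events"
proof (cases "e \<in> E")
  case True
  have "{F. F \<subseteq> E \<and> e \<in> F} \<in> sigma_sets (Pow E) {{F. F \<subseteq> E \<and> e \<in> F} | e. e \<in> E}"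
    using True by (intro sigma_sets.Basic) blast
  also have "\<dots> = sets (subgraph_space E)"
    unfolding subgraph_space_def by (rule sets_measure_of[symmetric]) auto
  also have "\<dots> = wsf.events" using wsf by (simp add: wired_spanning_forest_def)
  finally show ?thesis by (simp add: space_WSF)
next
  case False
  then have "{F \<in> space WSF. e \<in> F} = {}" by (auto simp: space_WSF)
  then show ?thesis by (metis sets.empty_sets)
qed

lemma subset_event:
  assumes "finite B" shows "{F \<in> space WSF. B \<subseteq> F} \<in> wsf.events"
proof -
  have "{F \<in> space WSF. \<forall>e\<in>B. e \<in> F} \<in> wsf.events"
    by (rule sets.sets_Collect_finite_All[OF edge_event assms])
  then show ?thesis by (simp add: subset_eq)
qed

lemma cylinder_event:
  assumes "finite K" shows "{F \<in> space WSF. F \<inter> K = A} \<in> wsf.events"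
proof (cases "A \<subseteq> K")
  case True
  have "{F \<in> space WSF. F \<inter> K = A} = {F \<in> space WSF. \<forall>e\<in>K. e \<in> F \<longleftrightarrow> e \<in> A}"
    using True by auto
  also have "\<dots> \<in> wsf.events"
  proof (rule sets.sets_Collect_finite_All)
    fix e show "{F \<in> space WSF. e \<in> F \<longleftrightarrow> e \<in> A} \<in> wsf.events"
      using edge_event sets.sets_Collect_neg[OF edge_event] by (cases "e \<in> A") simp_all
  qed fact
  finally show ?thesis .
next
  case False
  then have "{F \<in> space WSF. F \<inter> K = A} = {}" by auto
  then show ?thesis by (metis sets.empty_sets)
qed

lemma cylinder_pred_event:
  assumes "finite K" shows "{F \<in> space WSF. P (F \<inter> K)} \<in> wsf.events"
proof -
  have "{F \<in> space WSF. P (F \<inter> K)} = (\<Union>A\<in>{A \<in> Pow K. P A}. {F \<in> space WSF. F \<inter> K = A})" by auto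
  also have "\<dots> \<in> wsf.events"
    using assms by (intro sets.finite_UN cylinder_event) simp_all
  finally show ?thesis .
qed

text \<open>The defining convergence covers only events \<open>B \<subseteq> F\<close>. Excluded
  edges are added one at a time, each as a difference of two events that exclude one edge
  less.\<close>

lemma tendsto_subset_avoid:
  assumes "exhausting Z" "finite M" "M \<subseteq> E" "finite B" "B \<subseteq> E"
  shows "(\<lambda>R. measure_pmf.prob (USF E (Z R)) {F. B \<subseteq> F \<and> F \<inter> M = {}})
    \<longlonglongrightarrow> wsf.prob {F \<in> space WSF. B \<subseteq> F \<and> F \<inter> M = {}}"
  using assms(2-)
proof (induction M arbitrary: B)
  case empty
  then show ?case using wsf assms(1) by (simp add: wired_spanning_forest_def)
next
  case (insert e M)
  let ?A = "\<lambda>B. {F. B \<subseteq> F \<and> F \<inter> M = {}}" and ?A' = "\<lambda>B. {F \<in> space WSF. B \<subseteq> F \<and> F \<inter> M = {}}"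
  have ev: "?A' B \<in> wsf.events" if "finite B" for B
  proof -
    have "?A' B = {F \<in> space WSF. B \<subseteq> F \<inter> (B \<union> M) \<and> F \<inter> (B \<union> M) \<inter> M = {}}" by auto
    also have "\<dots> \<in> wsf.events"
      using cylinder_pred_event[of "B \<union> M" "\<lambda>A. B \<subseteq> A \<and> A \<inter> M = {}"] insert.hyps that by blast
    finally show ?thesis .
  qed
  have "{F. B \<subseteq> F \<and> F \<inter> insert e M = {}} = ?A B - ?A (insert e B)" by auto
  then have 1: "measure_pmf.prob (USF E (Z R)) {F. B \<subseteq> F \<and> F \<inter> insert e M = {}}
      = measure_pmf.prob (USF E (Z R)) (?A B) - measure_pmf.prob (USF E (Z R)) (?A (insert e B))" for R
    using measure_pmf.finite_measure_Diff[of "?A B" "USF E (Z R)" "?A (insert e B)"] by auto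
  have "{F \<in> space WSF. B \<subseteq> F \<and> F \<inter> insert e M = {}} = ?A' B - ?A' (insert e B)" by auto
  moreover have "?A' (insert e B) \<subseteq> ?A' B" by auto
  ultimately have 2: "wsf.prob {F \<in> space WSF. B \<subseteq> F \<and> F \<inter> insert e M = {}}
      = wsf.prob (?A' B) - wsf.prob (?A' (insert e B))"
    using wsf.finite_measure_Diff[OF ev ev, of B "insert e B"] insert.prems by simp
  show ?case unfolding 1 2
    by (intro tendsto_diff insert.IH) (use insert.prems in auto)
qed

lemma tendsto_cylinder_integral:
  fixes f :: "('v \<times> 'v) set \<Rightarrow> real"
  assumes "exhausting Z" "finite K" "K \<subseteq> E"
  shows "(\<lambda>R. measure_pmf.expectation (USF E (Z R)) (\<lambda>F. f (F \<inter> K))) \<longlonglongrightarrow> (\<integral>F. f (F \<inter> K) \<partial>WSF)"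
proof -
  have 1: "(\<integral>F. f (F \<inter> K) \<partial>WSF) = (\<Sum>A\<in>Pow K. f A * wsf.prob {F \<in> space WSF. F \<inter> K = A})"
    by (rule wsf.integral_cylinder(2)[where g = "\<lambda>F. F"]) (use assms cylinder_event in auto)
  have 2: "measure_pmf.expectation (USF E (Z R)) (\<lambda>F. f (F \<inter> K))
      = (\<Sum>A\<in>Pow K. f A * measure_pmf.prob (USF E (Z R)) {F. F \<inter> K = A})" for R
    using measure_pmf.integral_cylinder(2)[OF assms(2), where M = "USF E (Z R)" and g = "\<lambda>F. F" and f = f] by simp
  have 3: "(\<lambda>R. measure_pmf.prob (USF E (Z R)) {F. F \<inter> K = A})
      \<longlonglongrightarrow> wsf.prob {F \<in> space WSF. F \<inter> K = A}" if "A \<in> Pow K" for A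
  proof -
    have eq: "F \<inter> K = A \<longleftrightarrow> A \<subseteq> F \<and> F \<inter> (K - A) = {}" for F using that by auto
    show ?thesis
      unfolding eq by (rule tendsto_subset_avoid[OF assms(1)]) (use assms that in \<open>auto intro: finite_subset\<close>)
  qed
  show ?thesis unfolding 1 2
    by (intro tendsto_sum tendsto_mult tendsto_const 3)
qed

lemma tendsto_cylinder_prob:
  assumes "exhausting Z" "finite K" "K \<subseteq> E"
  shows "(\<lambda>R. measure_pmf.prob (USF E (Z R)) {F. P (F \<inter> K)}) \<longlonglongrightarrow> wsf.prob {F \<in> space WSF. P (F \<inter> K)}"
proof -
  have "(\<integral>F. of_bool (P (F \<inter> K)) \<partial>WSF) = (\<integral>F. indicator {F \<in> space WSF. P (F \<inter> K)} F \<partial>WSF)"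
    by (rule Bochner_Integration.integral_cong) (auto simp: indicator_def)
  also have "\<dots> = measure WSF ({F \<in> space WSF. P (F \<inter> K)} \<inter> space WSF)"
    by simp
  also have "{F \<in> space WSF. P (F \<inter> K)} \<inter> space WSF = {F \<in> space WSF. P (F \<inter> K)}" by auto
  finally have 1: "(\<integral>F. of_bool (P (F \<inter> K)) \<partial>WSF) = wsf.prob {F \<in> space WSF. P (F \<inter> K)}" .
  have 2: "measure_pmf.expectation (USF E (Z R)) (\<lambda>F. of_bool (P (F \<inter> K)))
      = measure_pmf.prob (USF E (Z R)) {F. P (F \<inter> K)}" for R
  proof -
    have "measure_pmf.expectation (USF E (Z R)) (\<lambda>F. of_bool (P (F \<inter> K)))
        = measure_pmf.expectation (USF E (Z R)) (indicator {F. P (F \<inter> K)})"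
      by (rule Bochner_Integration.integral_cong) (auto simp: indicator_def)
    also have "\<dots> = measure_pmf.prob (USF E (Z R)) ({F. P (F \<inter> K)} \<inter> space (USF E (Z R)))"
      by (rule Bochner_Integration.integral_indicator)
    finally show ?thesis by simp
  qed
  show ?thesis
    using tendsto_cylinder_integral[OF assms, of "\<lambda>A. of_bool (P A)"] by (simp only: 1 2)
qed

lemma set_USF: "finite (- Z) \<Longrightarrow> set_pmf (USF E Z) = forests Z"
  unfolding USF_def by (rule set_pmf_of_set[OF forests_nonempty[OF _ cofinite_nonempty] finite_forests])

lemma AE_WSF_cylinder:
  assumes "finite K" "K \<subseteq> E" "exhausting Z"
    and "eventually (\<lambda>R. \<forall>F\<in>forests (Z R). P (F \<inter> K)) sequentially"
  shows "AE F in WSF. P (F \<inter> K)"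
proof -
  have "eventually (\<lambda>R. measure_pmf.prob (USF E (Z R)) {F. P (F \<inter> K)} = 1) sequentially"
    using assms(4)
  proof eventually_elim
    case (elim R)
    then have "AE F in USF E (Z R). F \<in> {F. P (F \<inter> K)}"
      using set_USF[OF exhausting_finite[OF assms(3)], of R] by (auto simp: AE_measure_pmf_iff)
    then show ?case by (subst measure_pmf.prob_eq_1) auto
  qed
  then have "(\<lambda>R. measure_pmf.prob (USF E (Z R)) {F. P (F \<inter> K)}) \<longlonglongrightarrow> 1"
    by (rule tendsto_eventually)
  with tendsto_cylinder_prob[OF assms(3,1,2)] have "wsf.prob {F \<in> space WSF. P (F \<inter> K)} = 1"
    by (rule LIMSEQ_unique)
  then show ?thesis
    using wsf.prob_Collect_eq_1[OF cylinder_pred_event[OF assms(1)]] by blast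
qed

section \<open>Almost sure properties of the wired spanning forest\<close>

lemma AE_WSF_subset: "AE F in WSF. F \<subseteq> E"
  by (rule AE_I2) (simp add: space_WSF)

text \<open>The edges of \<open>E\<close> out of \<open>x\<close> are finitely many, so the out-edge
  cannot escape in the limit.\<close>

lemma AE_WSF_outdegree: "AE F in WSF. \<forall>x. \<exists>!y. (x, y) \<in> F"
proof -
  obtain Z :: "nat \<Rightarrow> 'v set" where Z: "exhausting Z" using ex_exhausting by blast
  have "AE F in WSF. \<exists>!y. (x, y) \<in> F" for x
  proof -
    let ?K = "E \<inter> {x} \<times> UNIV"
    have *: "(x, y) \<in> F \<inter> ?K \<longleftrightarrow> (x, y) \<in> F" if "F \<subseteq> E" for F y using that by auto
    have "AE F in WSF. \<exists>!y. (x, y) \<in> F \<inter> ?K"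
    proof (rule AE_WSF_cylinder[OF _ _ Z, where P = "\<lambda>A. \<exists>!y. (x, y) \<in> A"])
      show "eventually (\<lambda>R. \<forall>F\<in>forests (Z R). \<exists>!y. (x, y) \<in> F \<inter> ?K) sequentially"
        using exhausting_eventually[OF Z, of x]
      proof eventually_elim
        case (elim R)
        show ?case
        proof
          fix F assume "F \<in> forests (Z R)"
          then have F: "F \<subseteq> E" "\<exists>!y. (x, y) \<in> F" using elim by (auto simp: oriented_forest_def)
          show "\<exists>!y. (x, y) \<in> F \<inter> ?K" unfolding *[OF F(1)] by (rule F(2))
        qed
      qed
    qed (use finite_edges_from[of "{x}"] in auto)
    then show ?thesis using AE_WSF_subset
    proof eventually_elim
      case (elim F)
      show ?case using elim(1) unfolding *[OF elim(2)] .
    qed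
  qed
  then show ?thesis using AE_ball_countable[OF countable_vertices, of "\<lambda>F x. \<exists>!y. (x, y) \<in> F" WSF] by simp
qed

text \<open>A cycle uses finitely many edges, and only countably many finite edge sets have to be
  excluded.\<close>

lemma AE_WSF_acyclic: "AE F in WSF. acyclic F"
proof -
  obtain Z :: "nat \<Rightarrow> 'v set" where Z: "exhausting Z" using ex_exhausting by blast
  let ?\<B> = "{B. B \<subseteq> E \<and> finite B \<and> \<not> acyclic B}"
  have count: "countable ?\<B>"
    by (rule countable_subset[OF _ countable_Collect_finite_subset[OF countable_edges]]) auto
  have "AE F in WSF. \<not> B \<subseteq> F" if B: "B \<in> ?\<B>" for B
  proof -
    have "AE F in WSF. F \<inter> B \<noteq> B"
    proof (rule AE_WSF_cylinder[OF _ _ Z, where P = "\<lambda>A. A \<noteq> B"])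
      have "F \<inter> B \<noteq> B" if "F \<in> forests (Z R)" for F R
      proof
        assume "F \<inter> B = B"
        then have "B \<subseteq> F" by blast
        moreover have "acyclic F" using that by (simp add: oriented_forest_def)
        ultimately show False using B acyclic_subset by blast
      qed
      then show "eventually (\<lambda>R. \<forall>F\<in>forests (Z R). F \<inter> B \<noteq> B) sequentially" by simp
    qed (use B in auto)
    then show ?thesis by eventually_elim blast
  qed
  then have "AE F in WSF. \<forall>B\<in>?\<B>. \<not> B \<subseteq> F"
    using AE_ball_countable[OF count, of "\<lambda>F B. \<not> B \<subseteq> F" WSF] by blast
  then show ?thesis using AE_WSF_subset
  proof eventually_elim
    case (elim F)
    show ?case unfolding acyclic_def
    proof (intro allI notI)
      fix x assume "(x, x) \<in> F\<^sup>+"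
      then obtain B where B: "finite B" "B \<subseteq> F" "(x, x) \<in> B\<^sup>+" using trancl_finite_subset by metis
      then have "B \<in> ?\<B>" using elim(2) by (auto simp: acyclic_def)
      then show False using elim(1) B(2) by blast
    qed
  qed
qed

section \<open>Pasts under the wired spanning forest\<close>

lemma path_event: "{F \<in> space WSF. (w, q) \<in> F\<^sup>*} \<in> wsf.events"
proof -
  let ?\<B> = "{B. B \<subseteq> E \<and> finite B \<and> (w, q) \<in> B\<^sup>*}"
  have count: "countable ?\<B>"
    by (rule countable_subset[OF _ countable_Collect_finite_subset[OF countable_edges]]) auto
  have "{F \<in> space WSF. (w, q) \<in> F\<^sup>*} = (\<Union>B\<in>?\<B>. {F \<in> space WSF. B \<subseteq> F})"
  proof (intro subset_antisym subsetI)
    fix F assume F: "F \<in> {F \<in> space WSF. (w, q) \<in> F\<^sup>*}"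
    then obtain B where "finite B" "B \<subseteq> F" "(w, q) \<in> B\<^sup>*" using rtrancl_finite_subset[of w q F] by auto
    then show "F \<in> (\<Union>B\<in>?\<B>. {F \<in> space WSF. B \<subseteq> F})" using F by (auto simp: space_WSF)
  next
    fix F assume "F \<in> (\<Union>B\<in>?\<B>. {F \<in> space WSF. B \<subseteq> F})"
    then obtain B where "F \<in> space WSF" "B \<subseteq> F" "(w, q) \<in> B\<^sup>*" by blast
    then show "F \<in> {F \<in> space WSF. (w, q) \<in> F\<^sup>*}"
      using rtrancl_mono[of B F] by blast
  qed
  also have "\<dots> \<in> wsf.events"
    using count by (rule sets.countable_UN'') (simp add: subset_event)
  finally show ?thesis .
qed

lemma past_event: "{F \<in> space WSF. \<exists>w\<in>Y. (w, q) \<in> F\<^sup>*} \<in> wsf.events"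
proof -
  have "countable Y" by (rule countable_subset[OF _ countable_vertices]) simp
  have "{F \<in> space WSF. \<exists>w\<in>Y. (w, q) \<in> F\<^sup>*} = (\<Union>w\<in>Y. {F \<in> space WSF. (w, q) \<in> F\<^sup>*})" by auto
  also have "\<dots> \<in> wsf.events"
    using \<open>countable Y\<close> by (rule sets.countable_UN'') (rule path_event)
  finally show ?thesis .
qed

lemma past_prob_tendsto_WSF:
  assumes "exhausting Z" "finite (- Y)" "q \<notin> Y"
  shows "(\<lambda>R. measure_pmf.prob (USF E (Z R)) {F. \<exists>w\<in>Y. (w, q) \<in> F\<^sup>*})
    \<longlonglongrightarrow> wsf.prob {F \<in> space WSF. \<exists>w\<in>Y. (w, q) \<in> F\<^sup>*}"
proof -
  let ?K = "{(u, v) \<in> E. u \<notin> Y \<or> v \<notin> Y}" and ?P = "\<lambda>F. \<exists>w\<in>Y. (w, q) \<in> F\<^sup>*"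
  have "(\<lambda>R. measure_pmf.prob (USF E (Z R)) {F. ?P (F \<inter> ?K)}) \<longlonglongrightarrow> wsf.prob {F \<in> space WSF. ?P (F \<inter> ?K)}"
    by (rule tendsto_cylinder_prob[OF assms(1) finite_edges_meeting[OF assms(2)]]) auto
  moreover have "?P (F \<inter> ?K) \<longleftrightarrow> ?P F" if "F \<subseteq> E" for F
    by (rule past_meets_iff[OF that assms(3), symmetric])
  then have "{F \<in> space WSF. ?P (F \<inter> ?K)} = {F \<in> space WSF. ?P F}"
    unfolding space_WSF by blast
  moreover have "measure_pmf.prob (USF E (Z R)) {F. ?P (F \<inter> ?K)} = measure_pmf.prob (USF E (Z R)) {F. ?P F}" for R
  proof (rule measure_pmf.finite_measure_eq_AE)
    show "AE F in USF E (Z R). (F \<in> {F. ?P (F \<inter> ?K)}) = (F \<in> {F. ?P F})"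
      unfolding AE_measure_pmf_iff set_USF[OF exhausting_finite[OF assms(1)]] mem_Collect_eq
      using past_meets_iff[OF _ assms(3)] by (simp add: oriented_forest_def)
  qed auto
  ultimately show ?thesis by simp
qed

text \<open>The events decrease with \<open>R\<close>. A forest in all of them has a past of
  \<open>q\<close> meeting every \<open>Z R\<close>, hence an infinite one.\<close>

lemma past_prob_tendsto_0:
  assumes Z: "exhausting Z" and ends: "AE F in WSF. \<forall>C \<in> components F. card (ends F C) = 1"
  shows "(\<lambda>R. wsf.prob {F \<in> space WSF. \<exists>w\<in>Z R. (w, q) \<in> F\<^sup>*}) \<longlonglongrightarrow> 0"
proof -
  let ?A = "\<lambda>R. {F \<in> space WSF. \<exists>w\<in>Z R. (w, q) \<in> F\<^sup>*}"
  have "(\<lambda>R. wsf.prob (?A R)) \<longlonglongrightarrow> wsf.prob (\<Inter>R. ?A R)"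
  proof (rule wsf.finite_Lim_measure_decseq)
    show "range ?A \<subseteq> wsf.events" using past_event by blast
    have "decseq Z" using Z by (simp add: exhausting_def)
    then show "decseq ?A" unfolding decseq_def by blast
  qed
  moreover have "wsf.prob (\<Inter>R. ?A R) = 0"
  proof -
    have "AE F in WSF. F \<notin> (\<Inter>R. ?A R)"
      using AE_WSF_subset AE_WSF_outdegree AE_WSF_acyclic ends
    proof eventually_elim
      case (elim F)
      have "finite {w. (w, q) \<in> F\<^sup>*}"
        by (rule finite_past) (use elim in blast)+
      then have "eventually (\<lambda>R. \<forall>w\<in>{w. (w, q) \<in> F\<^sup>*}. w \<notin> Z R) sequentially"
        by (rule eventually_ball_finite) (use exhausting_eventually[OF Z] in blast)
      then obtain R where "\<forall>w\<in>{w. (w, q) \<in> F\<^sup>*}. w \<notin> Z R"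
        using eventually_happens'[OF sequentially_bot] by blast
      then show ?case by blast
    qed
    moreover have "(\<Inter>R. ?A R) \<in> wsf.events" using past_event by blast
    ultimately show ?thesis by (simp add: wsf.prob_eq_0)
  qed
  ultimately show ?thesis by simp
qed

end

section \<open>Late visits\<close>

context lgraph begin

text \<open>The forests not yet paid for by the Green function from \<open>w0\<close>. Excluding
  \<open>w0\<close> from the tree forces a root that moves along a path to \<open>w0\<close> to
  leave the tree.\<close>

definition spreading :: "'v set \<Rightarrow> 'v set \<Rightarrow> 'v \<Rightarrow> 'v \<Rightarrow> ('v \<times> 'v) set set" where
  "spreading Z Y w0 q = {F \<in> forests (insert q Z). (w0, q) \<notin> F\<^sup>* \<and> (\<exists>w\<in>Y. (w, q) \<in> F\<^sup>*)}"

text \<open>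
  The root can be moved from \<open>q\<close> to a neighbour \<open>r\<close> in the same tree by adding the edge from \<open>q\<close> to \<open>r\<close>
  and deleting the edge out of \<open>r\<close>; if \<open>r\<close> is in another tree, that edge attaches the tree of \<open>q\<close>
  to a forest rooted at \<open>Z\<close> only.
\<close>

lemma card_spreading_le:
  assumes fin: "finite (- Z)" and q: "q \<notin> Z" and r: "r \<notin> Z" and qr: "(q, r) \<in> E"
  shows "card (spreading Z Y w0 q)
    \<le> deg r * card (spreading Z Y w0 r) + card {F \<in> forests Z. \<exists>w\<in>Y. (w, q) \<in> F\<^sup>*}"
proof -
  let ?S = "spreading Z Y w0 q" and ?T = "spreading Z Y w0 r" and ?P = "{F \<in> forests Z. \<exists>w\<in>Y. (w, q) \<in> F\<^sup>*}"
  have "q \<noteq> r" using qr by auto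
  have fin_ins: "finite (forests (insert x Z))" for x
    by (rule finite_forests) (use fin in \<open>auto intro: finite_subset\<close>)
  have finT: "finite ?T" using fin_ins[of r] by (simp add: spreading_def)
  have finP: "finite ?P" using finite_forests[OF fin] by simp
  have "?S \<subseteq> (\<lambda>(F, v). insert (r, v) (F - {q} \<times> UNIV)) ` (?T \<times> E `` {r}) \<union> (\<lambda>F. F - {q} \<times> UNIV) ` ?P"
  proof
    fix F assume "F \<in> ?S"
    then have F: "oriented_forest E (insert q Z) F" and w0: "(w0, q) \<notin> F\<^sup>*"
      and "\<exists>w\<in>Y. (w, q) \<in> F\<^sup>*"
      by (auto simp: spreading_def)
    then obtain w where w: "w \<in> Y" "(w, q) \<in> F\<^sup>*" by blast
    have no_q: "(q, v) \<notin> F" for v using F by (auto simp: oriented_forest_def)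
    show "F \<in> (\<lambda>(F, v). insert (r, v) (F - {q} \<times> UNIV)) ` (?T \<times> E `` {r}) \<union> (\<lambda>F. F - {q} \<times> UNIV) ` ?P"
    proof (cases "(r, q) \<in> F\<^sup>*")
      case False
      let ?G = "insert (q, r) F"
      have "oriented_forest E Z ?G" by (rule forest_insert[OF F q qr False])
      moreover have "(w, q) \<in> ?G\<^sup>*" using w(2) rtrancl_mono[of F ?G] by blast
      ultimately have "?G \<in> ?P" using w(1) by blast
      moreover have "F = ?G - {q} \<times> UNIV" using no_q by auto
      ultimately show ?thesis by blast
    next
      case True
      have "\<exists>!v. (r, v) \<in> F"
        using F r \<open>q \<noteq> r\<close> by (simp add: oriented_forest_def)
      then obtain v where v: "(r, v) \<in> F" and v_uniq: "\<And>v'. (r, v') \<in> F \<Longrightarrow> v' = v"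
        by (elim ex1E) blast
      let ?F = "F - {r} \<times> UNIV" and ?G = "insert (q, r) (F - {r} \<times> UNIV)"
      have "r \<notin> insert q Z" using r \<open>q \<noteq> r\<close> by simp
      from forest_remove[OF F this] have 1: "oriented_forest E (insert q (insert r Z)) ?F"
        by (simp add: insert_commute)
      have "?F `` {r} = {}" by auto
      from rtrancl_from_sink[OF this] have "(r, q) \<notin> ?F\<^sup>*" using \<open>q \<noteq> r\<close> by simp
      then have G: "oriented_forest E (insert r Z) ?G"
        using q \<open>q \<noteq> r\<close> by (intro forest_insert[OF 1 _ qr]) auto
      have sub: "?F\<^sup>* \<subseteq> ?G\<^sup>*" by (rule rtrancl_mono) auto
      have "(w, q) \<in> ?F\<^sup>* \<or> (w, r) \<in> ?F\<^sup>*" by (rule rtrancl_avoid) fact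
      then have "(w, r) \<in> ?G\<^sup>*"
        using sub by (meson insertI1 rtrancl.rtrancl_into_rtrancl subsetD)
      \<comment> \<open>Whatever leads to \<open>r\<close> in \<open>?G\<close> leads to
        \<open>q\<close> in \<open>F\<close>: apart from the new edge out of \<open>q\<close>, all
        edges belong to \<open>F\<close>, and \<open>r\<close> itself leads to
        \<open>q\<close>.\<close>
      moreover have "(w0, r) \<notin> ?G\<^sup>*"
      proof
        assume "(w0, r) \<in> ?G\<^sup>*"
        then have "(w0, q) \<in> F\<^sup>*"
        proof (induction rule: converse_rtrancl_induct)
          case (step u u')
          then show ?case by (cases "u = q") (auto intro: converse_rtrancl_into_rtrancl)
        qed (rule True)
        then show False using w0 by simp
      qed
      ultimately have "?G \<in> ?T" using G w(1) by (auto simp: spreading_def)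
      moreover have "(r, v) \<in> E" using v F by (auto simp: oriented_forest_def)
      \<comment> \<open>Undoing the move requires the end \<open>v\<close> of the deleted edge,
        whence the factor \<open>deg r\<close>.\<close>
      moreover have "F = insert (r, v) (?G - {q} \<times> UNIV)" using v v_uniq no_q by blast
      ultimately have "F \<in> (\<lambda>(F, v). insert (r, v) (F - {q} \<times> UNIV)) ` (?T \<times> E `` {r})"
        by (intro image_eqI[of _ _ "(?G, v)"]) simp_all
      then show ?thesis by blast
    qed
  qed
  then have "card ?S \<le> card ((\<lambda>(F, v). insert (r, v) (F - {q} \<times> UNIV)) ` (?T \<times> E `` {r}) \<union> (\<lambda>F. F - {q} \<times> UNIV) ` ?P)"
    using finT finP by (intro card_mono) auto
  also have "\<dots> \<le> card ((\<lambda>(F, v). insert (r, v) (F - {q} \<times> UNIV)) ` (?T \<times> E `` {r})) + card ((\<lambda>F. F - {q} \<times> UNIV) ` ?P)"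
    by (rule card_Un_le)
  also have "\<dots> \<le> card (?T \<times> E `` {r}) + card ?P"
    using finT finP by (intro add_mono card_image_le) auto
  finally show ?thesis by (simp add: card_cartesian_product mult.commute)
qed

end

section \<open>Locality of the killed rotor walk\<close>

context rotor_system begin

lemma rotor_step_agree:
  assumes "\<forall>y. y \<notin> Y \<longrightarrow> \<rho> y = \<rho>' y" "\<forall>s<t. rotor_walk \<tau> a \<rho> s \<notin> Y"
  shows "rotor_walk \<tau> a \<rho> t = rotor_walk \<tau> a \<rho>' t \<and>
    (\<forall>y. y \<notin> Y \<longrightarrow> snd ((rotor_step \<tau> ^^ t) (a, \<rho>)) y = snd ((rotor_step \<tau> ^^ t) (a, \<rho>')) y)"
  using assms(2)
proof (induction t)
  case 0
  then show ?case using assms(1) by (simp add: rotor_walk_def)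
next
  case (Suc t)
  obtain x \<sigma> where x: "(rotor_step \<tau> ^^ t) (a, \<rho>) = (x, \<sigma>)" by fastforce
  obtain x' \<sigma>' where x': "(rotor_step \<tau> ^^ t) (a, \<rho>') = (x', \<sigma>')" by fastforce
  have "x' = x" "\<forall>y. y \<notin> Y \<longrightarrow> \<sigma> y = \<sigma>' y" "x \<notin> Y"
    using Suc.IH Suc.prems x x' by (auto simp: rotor_walk_def)
  then show ?case
    unfolding rotor_walk_def rotor_walk_Suc[OF x] rotor_walk_Suc[OF x'] by simp
qed

lemma visit_times_cong:
  assumes "\<forall>y. y \<notin> Y \<longrightarrow> \<rho> y = \<rho>' y"
  shows "visit_times Y \<rho> x = visit_times Y \<rho>' x"
proof -
  \<comment> \<open>The disjunction makes the claim usable whichever walk is known to avoid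
    \<open>Y\<close>; agreement at earlier times turns one alternative into the other.\<close>
  have agree: "rotor_walk \<tau> a \<rho> t = rotor_walk \<tau> a \<rho>' t"
    if "\<forall>s<t. rotor_walk \<tau> a \<rho> s \<notin> Y \<or> rotor_walk \<tau> a \<rho>' s \<notin> Y" for t
    using that
  proof (induction t rule: less_induct)
    case (less t)
    then have "\<forall>s<t. rotor_walk \<tau> a \<rho> s \<notin> Y" by (metis order_less_trans)
    with rotor_step_agree[OF assms] show ?case by blast
  qed
  have "rotor_walk \<tau> a \<rho> s = rotor_walk \<tau> a \<rho>' s"
    if "\<forall>s\<le>t. rotor_walk \<tau> a \<rho> s \<notin> Y" "s \<le> t" for s t
    using that by (intro agree) auto
  moreover have "rotor_walk \<tau> a \<rho> s = rotor_walk \<tau> a \<rho>' s"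
    if "\<forall>s\<le>t. rotor_walk \<tau> a \<rho>' s \<notin> Y" "s \<le> t" for s t
    using that by (intro agree) auto
  ultimately show ?thesis unfolding visit_times_def by (safe; metis order_refl)
qed

lemma visit_times_mono: "Z \<subseteq> Y \<Longrightarrow> visit_times Y \<rho> x \<subseteq> visit_times Z \<rho> x"
  by (auto simp: visit_times_def)

end

section \<open>Bounds on late visits\<close>

locale rotor_wsf = wsf_graph E WSF + rotor_system E \<tau> a
  for E :: "('v \<times> 'v) set" and WSF :: "('v \<times> 'v) set measure" and \<tau> :: "'v \<Rightarrow> 'v \<Rightarrow> 'v" and a :: 'v +
  fixes Z :: "nat \<Rightarrow> 'v set"
  assumes Z: "exhausting Z"
    and one_end: "AE F in WSF. \<forall>C \<in> components F. card (ends F C) = 1"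
begin

lemma finZ [simp]: "finite (- Z R)"
  using Z by (rule exhausting_finite)

lemma neZ: "Z R \<noteq> {}"
  by (rule cofinite_nonempty) simp

abbreviation N :: "nat \<Rightarrow> real" where "N R \<equiv> real (card (forests (Z R)))"

lemma expectation_USF:
  "measure_pmf.expectation (USF E (Z R)) f = (\<Sum>F\<in>forests (Z R). f F) / N R" for f :: "_ \<Rightarrow> real"
  unfolding USF_def
  by (rule integral_pmf_of_set[OF forests_nonempty[OF finZ neZ] finite_forests[OF finZ]])

lemma prob_USF: "measure_pmf.prob (USF E (Z R)) A = card {F \<in> forests (Z R). F \<in> A} / N R"
  unfolding USF_def
  by (subst measure_pmf_of_set[OF forests_nonempty[OF finZ neZ] finite_forests[OF finZ]]) (simp add: Int_def)

lemma eventually_notin: "eventually (\<lambda>R. w \<notin> Z R) sequentially"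
  by (rule exhausting_eventually[OF Z])

text \<open>Induction along a path from \<open>q\<close> to \<open>w0\<close>; at \<open>w0\<close>
  the set is empty, as \<open>w0\<close> lies in its own tree. First \<open>R\<close> is chosen so
  that pasts meeting \<open>Z R\<close> are rare in infinite volume, then \<open>R'\<close> so that
  \<open>USF E (Z R')\<close> is close to it on this local event.\<close>

lemma spreading_small:
  assumes "0 < \<epsilon>"
  shows "eventually (\<lambda>R. eventually (\<lambda>R'. card (spreading (Z R') (Z R) w0 q) / N R' \<le> \<epsilon>) sequentially) sequentially"
  using conn[of q w0] assms
proof (induction arbitrary: \<epsilon> rule: converse_rtrancl_induct)
  case base
  then show ?case by (simp add: spreading_def)
next
  case (step q r)
  \<comment> \<open>Half of \<open>\<epsilon>\<close> is spent on moving the root, at the cost of a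
    factor \<open>deg r\<close>, and half on the past of \<open>q\<close>.\<close>
  have "0 < \<epsilon> / (2 * deg r)" using step.prems by simp
  note IH = step.IH[OF this]
  have "eventually (\<lambda>R. wsf.prob {F \<in> space WSF. \<exists>w\<in>Z R. (w, q) \<in> F\<^sup>*} < \<epsilon> / 2) sequentially"
    using step.prems by (intro order_tendstoD(2)[OF past_prob_tendsto_0[OF Z one_end]]) simp
  with IH show ?case using eventually_notin[of q]
  proof eventually_elim
    case (elim R)
    from past_prob_tendsto_WSF[OF Z finZ elim(3)] elim(2)
    have "eventually (\<lambda>R'. measure_pmf.prob (USF E (Z R')) {F. \<exists>w\<in>Z R. (w, q) \<in> F\<^sup>*} < \<epsilon> / 2) sequentially"
      by (rule order_tendstoD(2))
    with elim(1) eventually_notin[of q] eventually_notin[of r] show ?case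
    proof eventually_elim
      case (elim R')
      have "card (spreading (Z R') (Z R) w0 q) / N R'
          \<le> (deg r * card (spreading (Z R') (Z R) w0 r) + card {F \<in> forests (Z R'). \<exists>w\<in>Z R. (w, q) \<in> F\<^sup>*}) / N R'"
        using card_spreading_le[OF finZ elim(2,3) step.hyps(1), of "Z R" w0]
        by (intro divide_right_mono) (simp_all flip: of_nat_mult of_nat_add)
      also have "\<dots> = deg r * (card (spreading (Z R') (Z R) w0 r) / N R')
          + measure_pmf.prob (USF E (Z R')) {F. \<exists>w\<in>Z R. (w, q) \<in> F\<^sup>*}"
        by (simp add: prob_USF add_divide_distrib)
      also have "\<dots> \<le> deg r * (\<epsilon> / (2 * deg r)) + \<epsilon> / 2"
        using elim by (intro add_mono mult_left_mono) auto
      also have "\<dots> = \<epsilon>" by (simp add: field_simps)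
      finally show ?case .
    qed
  qed
qed

text \<open>Forests with \<open>w0\<close> in the tree of \<open>x\<close> contribute the killed
  Green function from \<open>w0\<close>, which is below \<open>\<epsilon> / 2\<close>; all others
  are in \<open>spreading\<close>.\<close>

lemma late_small:
  assumes "0 < \<epsilon>"
  shows "eventually (\<lambda>R. eventually (\<lambda>R'.
    deg x * card {F \<in> forests (insert x (Z R')). \<exists>w\<in>Z R. (w, x) \<in> F\<^sup>*} / N R' \<le> \<epsilon>) sequentially) sequentially"
proof -
  obtain w0 where w0: "Green w0 x < \<epsilon> / 2" using ex_Green_less[of "\<epsilon> / 2"] assms by auto
  have "0 < \<epsilon> / (2 * deg x)" using assms by simp
  from spreading_small[OF this, of w0 x] show ?thesis
  proof eventually_elim
    case (elim R)
    then show ?case using eventually_notin[of x]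
    proof eventually_elim
      case (elim R')
      let ?A = "{F \<in> forests (insert x (Z R')). \<exists>w\<in>Z R. (w, x) \<in> F\<^sup>*}"
      let ?L = "{F \<in> forests (insert x (Z R')). (w0, x) \<in> F\<^sup>*}"
      let ?S = "spreading (Z R') (Z R) w0 x"
      have fin: "finite (forests (insert x (Z R')))"
        by (rule finite_forests) (use finZ[of R'] in \<open>auto intro: finite_subset\<close>)
      have "card ?A \<le> card (?L \<union> ?S)"
        by (rule card_mono) (use fin in \<open>auto simp: spreading_def\<close>)
      also have "\<dots> \<le> card ?L + card ?S" by (rule card_Un_le)
      finally have "real (card ?A) \<le> linked (Z R') x w0 + card ?S"
        by (simp add: linked_card)
      then have "deg x * card ?A / N R' \<le> deg x * (linked (Z R') x w0 + card ?S) / N R'"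
        by (intro divide_right_mono mult_left_mono) auto
      also have "\<dots> = killed_green (Z R') w0 x + deg x * (card ?S / N R')"
        by (simp add: killed_green_def distrib_left add_divide_distrib)
      also have "\<dots> \<le> \<epsilon> / 2 + deg x * (\<epsilon> / (2 * deg x))"
        using elim killed_green_le_Green[OF finZ neZ elim(2), of w0] w0
        by (intro add_mono mult_left_mono) auto
      also have "\<dots> = \<epsilon>" by (simp add: field_simps)
      finally show ?case .
    qed
  qed
qed

section \<open>Passage to the infinite-volume expectation\<close>

abbreviation killed_visits :: "nat \<Rightarrow> 'v \<Rightarrow> ('v \<times> 'v) set \<Rightarrow> real" where
  "killed_visits R x F \<equiv> real (card (visit_times (Z R) (rotor_of F) x))"

lemma killed_visits_local:
  assumes "F \<subseteq> E"
  shows "killed_visits R x F = killed_visits R x (F \<inter> (E \<inter> (- Z R) \<times> UNIV))"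
proof -
  have "(y, v) \<in> F \<inter> (E \<inter> (- Z R) \<times> UNIV) \<longleftrightarrow> (y, v) \<in> F" if "y \<notin> Z R" for y v
    using that assms by auto
  then have "\<forall>y. y \<notin> Z R \<longrightarrow> rotor_of F y = rotor_of (F \<inter> (E \<inter> (- Z R) \<times> UNIV)) y"
    by (simp add: rotor_of_def)
  from visit_times_cong[OF this] show ?thesis by simp
qed

lemma integrable_killed_visits: "integrable WSF (killed_visits R x)"
proof -
  let ?K = "E \<inter> (- Z R) \<times> UNIV"
  have "integrable WSF (killed_visits R x) \<longleftrightarrow> integrable WSF (\<lambda>F. killed_visits R x (F \<inter> ?K))"
    by (rule Bochner_Integration.integrable_cong[OF refl]) (rule killed_visits_local, simp add: space_WSF)
  then show ?thesis
    using wsf.integral_cylinder(1)[of ?K "\<lambda>F. F" "killed_visits R x"] finite_edges_from[OF finZ] cylinder_event by simp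
qed

lemma killed_visits_tendsto:
  "(\<lambda>R'. (\<Sum>F\<in>forests (Z R'). killed_visits R x F) / N R') \<longlonglongrightarrow> (\<integral>F. killed_visits R x F \<partial>WSF)"
proof -
  let ?K = "E \<inter> (- Z R) \<times> UNIV"
  have "(\<lambda>R'. measure_pmf.expectation (USF E (Z R')) (\<lambda>F. killed_visits R x (F \<inter> ?K)))
      \<longlonglongrightarrow> (\<integral>F. killed_visits R x (F \<inter> ?K) \<partial>WSF)"
    by (rule tendsto_cylinder_integral[OF Z finite_edges_from[OF finZ]]) simp
  moreover have "(\<integral>F. killed_visits R x F \<partial>WSF) = (\<integral>F. killed_visits R x (F \<inter> ?K) \<partial>WSF)"
    by (rule Bochner_Integration.integral_cong[OF refl]) (rule killed_visits_local, simp add: space_WSF)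
  moreover have "(\<Sum>F\<in>forests (Z R'). killed_visits R x F) = (\<Sum>F\<in>forests (Z R'). killed_visits R x (F \<inter> ?K))" for R'
    by (rule sum.cong[OF refl], rule killed_visits_local) (auto simp: oriented_forest_def)
  ultimately show ?thesis by (simp only: expectation_USF)
qed

lemma sum_killed_visits:
  assumes "a \<notin> Z R" "x \<notin> Z R"
  shows "(\<Sum>F\<in>forests (Z R). killed_visits R x F) / N R = killed_green (Z R) a x"
  using sum_visits_forests[OF finZ neZ assms] by (simp add: killed_green_def)

text \<open>For \<open>R \<le> R'\<close>, killing at the larger set \<open>Z R\<close> loses
  visits, and killing at \<open>Z R'\<close> gives exactly the mean
  \<open>killed_green (Z R') a x\<close> under \<open>USF E (Z R')\<close>.\<close>

lemma expected_killed_visits_le: "(\<integral>F. killed_visits R x F \<partial>WSF) \<le> Green a x"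
proof (rule tendsto_le[OF sequentially_bot killed_green_tendsto[OF Z] killed_visits_tendsto])
  have "eventually (\<lambda>R'. R \<le> R') sequentially" by (rule eventually_ge_at_top)
  then show "eventually (\<lambda>R'. (\<Sum>F\<in>forests (Z R'). killed_visits R x F) / N R' \<le> killed_green (Z R') a x) sequentially"
    using eventually_notin[of a] eventually_notin[of x]
  proof eventually_elim
    case (elim R')
    have sub: "Z R' \<subseteq> Z R" using Z elim(1) by (auto simp: exhausting_def decseq_def)
    have "(\<Sum>F\<in>forests (Z R'). killed_visits R x F) / N R' \<le> (\<Sum>F\<in>forests (Z R'). killed_visits R' x F) / N R'"
      using finite_visit_times_forest[OF finZ neZ order_refl] visit_times_mono[OF sub]
      by (intro divide_right_mono sum_mono of_nat_mono card_mono) auto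
    then show ?case using sum_killed_visits[OF elim(2,3)] by simp
  qed
qed

text \<open>What killing at \<open>Z R\<close> loses against killing at \<open>Z R'\<close> are the
  late visits, whose mean is at most \<open>\<epsilon>\<close> for all large \<open>R'\<close>. The
  bound therefore survives the limit in \<open>R'\<close>.\<close>

lemma expected_killed_visits_ge:
  assumes "0 < \<epsilon>"
  shows "eventually (\<lambda>R. Green a x - \<epsilon> \<le> (\<integral>F. killed_visits R x F \<partial>WSF)) sequentially"
  using late_small[OF assms, of x]
proof eventually_elim
  case (elim R)
  show ?case
  proof (rule tendsto_le[OF sequentially_bot killed_visits_tendsto])
    show "(\<lambda>R'. killed_green (Z R') a x - \<epsilon>) \<longlonglongrightarrow> Green a x - \<epsilon>"
      by (intro tendsto_diff tendsto_const killed_green_tendsto Z)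
    have "eventually (\<lambda>R'. R \<le> R') sequentially" by (rule eventually_ge_at_top)
    with elim show "eventually (\<lambda>R'. killed_green (Z R') a x - \<epsilon>
        \<le> (\<Sum>F\<in>forests (Z R'). killed_visits R x F) / N R') sequentially"
      using eventually_notin[of a] eventually_notin[of x]
    proof eventually_elim
      case (elim R')
      have sub: "Z R' \<subseteq> Z R" using Z elim(2) by (auto simp: exhausting_def decseq_def)
      have "(\<Sum>F\<in>forests (Z R'). killed_visits R' x F - killed_visits R x F) / N R' \<le> \<epsilon>"
        using divide_right_mono[OF sum_late_visits[OF finZ neZ elim(3,4) sub], of "N R'"] elim(1) by simp
      then show ?case
        using sum_killed_visits[OF elim(3,4)] by (simp add: sum_subtractf diff_divide_distrib)
    qed
  qed
qed

lemma expected_killed_visits_tendsto: "(\<lambda>R. \<integral>F. killed_visits R x F \<partial>WSF) \<longlonglongrightarrow> Green a x"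
proof (rule tendstoI)
  fix \<epsilon> :: real assume "0 < \<epsilon>"
  then have "0 < \<epsilon> / 2" by simp
  from expected_killed_visits_ge[OF this, of x]
  show "eventually (\<lambda>R. dist (\<integral>F. killed_visits R x F \<partial>WSF) (Green a x) < \<epsilon>) sequentially"
  proof eventually_elim
    case (elim R)
    then show ?case using expected_killed_visits_le[of R x] \<open>0 < \<epsilon>\<close> by (simp add: dist_real_def)
  qed
qed

text \<open>Up to a given time the walk has seen finitely many vertices, all of them off
  \<open>Z R\<close> for large \<open>R\<close>.\<close>

lemma visits_eq_SUP:
  assumes "F \<subseteq> E" "\<forall>x. \<exists>!y. (x, y) \<in> F"
  shows "visits (rotor_walk \<tau> a (rotor_of F)) x = (SUP R. ennreal (killed_visits R x F))"
    and "incseq (\<lambda>R. killed_visits R x F)"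
proof -
  let ?V = "\<lambda>R. visit_times (Z R) (rotor_of F) x"
  have rot: "(y, rotor_of F y) \<in> E" for y
    using assms theI'[of "\<lambda>v. (y, v) \<in> F"] by (auto simp: rotor_of_def)
  have fin: "finite (?V R)" for R by (rule finite_visit_times[OF finZ neZ rot])
  have dec: "decseq Z" using Z by (simp add: exhausting_def)
  have inc: "incseq ?V"
    unfolding incseq_def using decseqD[OF dec] visit_times_mono by blast
  show "incseq (\<lambda>R. killed_visits R x F)"
    unfolding incseq_def using card_mono[OF fin] incseqD[OF inc] by simp
  have "{t. rotor_walk \<tau> a (rotor_of F) t = x} = (\<Union>R. ?V R)"
  proof (intro subset_antisym subsetI)
    fix t assume t: "t \<in> {t. rotor_walk \<tau> a (rotor_of F) t = x}"
    have "eventually (\<lambda>R. \<forall>s\<in>{..t}. rotor_walk \<tau> a (rotor_of F) s \<notin> Z R) sequentially"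
      by (rule eventually_ball_finite) (use eventually_notin in auto)
    then obtain R where "\<forall>s\<in>{..t}. rotor_walk \<tau> a (rotor_of F) s \<notin> Z R"
      using eventually_happens'[OF sequentially_bot] by blast
    then show "t \<in> (\<Union>R. ?V R)" using t by (auto simp: visit_times_def)
  qed (auto simp: visit_times_def)
  then have "visits (rotor_walk \<tau> a (rotor_of F)) x = emeasure (count_space UNIV) (\<Union>R. ?V R)"
    by (simp add: visits_def)
  also have "\<dots> = (SUP R. emeasure (count_space UNIV) (?V R))"
    by (rule SUP_emeasure_incseq[symmetric]) (use inc in auto)
  also have "\<dots> = (SUP R. ennreal (killed_visits R x F))"
    using fin by (simp add: emeasure_count_space_finite ennreal_of_nat_eq_real_of_nat)
  finally show "visits (rotor_walk \<tau> a (rotor_of F)) x = (SUP R. ennreal (killed_visits R x F))" .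
qed

lemma AE_good: "AE F in WSF. F \<subseteq> E \<and> (\<forall>x. \<exists>!y. (x, y) \<in> F)"
  using AE_WSF_subset AE_WSF_outdegree by eventually_elim blast

lemma expected_visits: "(\<integral>\<^sup>+ F. visits (rotor_walk \<tau> a (rotor_of F)) x \<partial>WSF) = green E a x"
proof -
  have "(\<integral>\<^sup>+ F. visits (rotor_walk \<tau> a (rotor_of F)) x \<partial>WSF) = (\<integral>\<^sup>+ F. (SUP R. ennreal (killed_visits R x F)) \<partial>WSF)"
    by (rule nn_integral_cong_AE, rule AE_mp[OF AE_good AE_I2]) (auto intro: visits_eq_SUP(1))
  also have "\<dots> = (SUP R. \<integral>\<^sup>+ F. ennreal (killed_visits R x F) \<partial>WSF)"
  proof (rule nn_integral_monotone_convergence_SUP_AE)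
    show "AE F in WSF. ennreal (killed_visits R x F) \<le> ennreal (killed_visits (Suc R) x F)" for R
      using AE_good
    proof eventually_elim
      case (elim F)
      then have "incseq (\<lambda>R. killed_visits R x F)" by (intro visits_eq_SUP(2)) auto
      then show ?case by (intro ennreal_leI) (rule incseq_SucD)
    qed
    show "(\<lambda>F. ennreal (killed_visits R x F)) \<in> borel_measurable WSF" for R
      using borel_measurable_integrable[OF integrable_killed_visits] by (rule measurable_compose) measurable
  qed
  also have "\<dots> = (SUP R. ennreal (\<integral>F. killed_visits R x F \<partial>WSF))"
    by (subst nn_integral_eq_integral) (use integrable_killed_visits in auto)
  also have "\<dots> = ennreal (Green a x)"
  proof (rule antisym)
    show "(SUP R. ennreal (\<integral>F. killed_visits R x F \<partial>WSF)) \<le> ennreal (Green a x)"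
      by (intro SUP_least ennreal_leI expected_killed_visits_le)
    have "(\<lambda>R. ennreal (\<integral>F. killed_visits R x F \<partial>WSF)) \<longlonglongrightarrow> ennreal (Green a x)"
      by (rule tendsto_ennrealI[OF expected_killed_visits_tendsto])
    then show "ennreal (Green a x) \<le> (SUP R. ennreal (\<integral>F. killed_visits R x F \<partial>WSF))"
      by (rule LIMSEQ_le_const2) (intro exI allI impI SUP_upper UNIV_I)
  qed
  finally show ?thesis by (simp add: green_eq_Green)
qed

end

text \<open>Without neighbours, \<open>v\<close> is the only vertex by connectivity. The instruction
  then has the default law \<open>pmf_of_set {}\<close>, but in a one-element type its value can
  only be \<open>v\<close>, so the walk returns surely.\<close>

lemma transient_no_isolated_vertex:
  fixes E :: "('v \<times> 'v) set"
  assumes "connected_graph E" "transient E"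
  shows "E `` {v} \<noteq> {}"
proof
  assume empty: "E `` {v} = {}"
  have "y = v" for y
  proof -
    have "(v, y) \<in> E\<^sup>*" using assms(1) by (simp add: connected_graph_def)
    then show ?thesis using empty by (metis Image_singleton_iff converse_rtranclE empty_iff)
  qed
  then have "srw v \<omega> 1 = v" for \<omega> by blast
  then have all: "{\<omega> \<in> space (srw_space E). \<exists>t>0. srw v \<omega> t = v} = space (srw_space E)"
    using zero_less_one by blast
  interpret prob_space "srw_space E"
    unfolding srw_space_def by (intro prob_space_PiM prob_space_measure_pmf)
  have "prob {\<omega> \<in> space (srw_space E). \<exists>t>0. srw v \<omega> t = v} = 1"
    unfolding all by (rule prob_space)
  then show False using assms(2) by (auto simp: transient_def dest!: spec[of _ v])
qed

theorem theorem1p3: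
  fixes E :: "('v \<times> 'v) set" and \<tau> :: "'v \<Rightarrow> 'v \<Rightarrow> 'v" and a :: 'v
    and WSF :: "('v \<times> 'v) set measure"
  assumes "simple_graph E" and "connected_graph E" and "locally_finite E" and "transient E"
    and "\<forall>x. local_mechanism E x (\<tau> x)"
    and "wired_spanning_forest E WSF"
    and "AE F in WSF. \<forall>C \<in> components F. card (ends F C) = 1"
  shows "\<forall>x. (\<integral>\<^sup>+ F. visits (rotor_walk \<tau> a (rotor_of F)) x \<partial>WSF) = green E a x"
proof -
  interpret transient_graph E
    using assms(1-4) transient_no_isolated_vertex[OF assms(2,4)]
    by unfold_locales (auto simp: simple_graph_def connected_graph_def locally_finite_def)
  \<comment> \<open>Any exhaustion serves, since \<open>wired_spanning_forest\<close> asserts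
    convergence along each of them.\<close>
  obtain Z :: "nat \<Rightarrow> 'v set" where "exhausting Z" using ex_exhausting by blast
  then interpret rotor_wsf E WSF \<tau> a Z
    using assms(5-7) by unfold_locales auto
  show ?thesis using expected_visits by blast
qed

end
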